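(* Let $R$ be a commutative Noetherian ring with identity, let $\mathbf{x}=x_1,\ldots,x_d$ be a regular $R$-sequence contained in the Jacobson radical of $R$, suppose that $\mathbf{x}R=x_1R+\cdots+x_dR$ is a prime ideal of $R$, and let $I$ be a monomial ideal of $R$ with respect to $\mathbf{x}$. Then: (a) for every integer $k\ge 1$, the $k$th symbolic power $I^{(k)}$ is a monomial ideal with respect to $\mathbf{x}$; (b) if $I$ is squarefree, then for every integer $k\geq 1$, $I^{(k)}=I^k$ if and only if $\operatorname{Ass}_R R/I^k\subseteq \operatorname{Ass}_R R/I$; (c) if $I$ is squarefree and the equivalent conditions in (b) hold for all integers $k\geq 1$, then $I$ is normal and $I^k=\bigcap_{\mathfrak{p}\in \operatorname{mAss}_R R/I}\mathfrak{p}^k$ for all $k\ge 1$.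
   Context: A monomial with respect to $\mathbf{x}$ is an element $x_1^{e_1}\cdots x_d^{e_d}$ with $e_1,\ldots,e_d$ non-negative integers; it is squarefree if all $e_i\in\{0,1\}$. A monomial ideal with respect to $\mathbf{x}$ is a proper ideal of $R$ generated by monomials (the zero ideal is allowed); it is squarefree if it is generated by squarefree monomials. $\operatorname{mAss}_R R/I$ denotes the set of minimal elements of $\operatorname{Ass}_R R/I$. For a positive integer $n$, the symbolic power $I^{(n)}$ is the intersection of the primary components of $I^n$ corresponding to the minimal associated primes of $I$. An ideal $J$ is integrally closed if it equals its integral closure $\overline{J}$, the set of $x\in R$ satisfying $x^n+c_1x^{n-1}+\cdots+c_n=0$ for some $n\ge 1$ and $c_i\in J^i$. An ideal $J$ is normal if $J^n$ is integrally closed for every integer $n\ge 1$. *)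

theory Defs
  imports "HOL-Algebra.Ring_Divisibility" "HOL-Algebra.Ideal_Product" "HOL-Algebra.Module"
begin

section \<open>Ideals and regular sequences\<close>

definition jacobson_radical :: "('a, 'b) ring_scheme \<Rightarrow> 'a set"
  where "jacobson_radical R = carrier R \<inter> \<Inter> {M. maximalideal M R}"

text \<open>
  A finite sequence \<open>x\<^sub>1, \<dots>, x\<^sub>d\<close> is a function on the naturals of which only the values on
  \<open>{1..d}\<close> matter.  The second conjunct says that each \<open>x\<^sub>i\<close> is not a
  zero divisor on \<open>R / (x\<^sub>1, \<dots>, x\<^sub>i\<^sub>-\<^sub>1)\<close>.
\<close>

definition regular_sequence :: "('a, 'b) ring_scheme \<Rightarrow> (nat \<Rightarrow> 'a) \<Rightarrow> nat \<Rightarrow> bool"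
  where "regular_sequence R x d \<longleftrightarrow>
    x ` {1..d} \<subseteq> carrier R \<and>
    (\<forall>i\<in>{1..d}. \<forall>r\<in>carrier R.
       x i \<otimes>\<^bsub>R\<^esub> r \<in> Idl\<^bsub>R\<^esub> (x ` {1..<i}) \<longrightarrow> r \<in> Idl\<^bsub>R\<^esub> (x ` {1..<i})) \<and>
    Idl\<^bsub>R\<^esub> (x ` {1..d}) \<noteq> carrier R"

definition ideal_power :: "('a, 'b) ring_scheme \<Rightarrow> 'a set \<Rightarrow> nat \<Rightarrow> 'a set"
  where "ideal_power R I n = I [^]\<^bsub>ideals_set R\<^esub> n"

definition radical :: "('a, 'b) ring_scheme \<Rightarrow> 'a set \<Rightarrow> 'a set"
  where "radical R I = {a \<in> carrier R. \<exists>n::nat. n \<ge> 1 \<and> a [^]\<^bsub>R\<^esub> n \<in> I}"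


section \<open>Monomial ideals\<close>

definition monomial :: "('a, 'b) ring_scheme \<Rightarrow> (nat \<Rightarrow> 'a) \<Rightarrow> nat \<Rightarrow> (nat \<Rightarrow> nat) \<Rightarrow> 'a"
  where "monomial R x d e = (\<Otimes>\<^bsub>R\<^esub>i\<in>{1..d}. x i [^]\<^bsub>R\<^esub> e i)"

definition monomials :: "('a, 'b) ring_scheme \<Rightarrow> (nat \<Rightarrow> 'a) \<Rightarrow> nat \<Rightarrow> 'a set"
  where "monomials R x d = {monomial R x d e | e. True}"

definition squarefree_monomials :: "('a, 'b) ring_scheme \<Rightarrow> (nat \<Rightarrow> 'a) \<Rightarrow> nat \<Rightarrow> 'a set"
  where "squarefree_monomials R x d = {monomial R x d e | e. \<forall>i\<in>{1..d}. e i \<in> {0, 1}}"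

text \<open>The generating set may be empty, which gives the zero ideal.\<close>

definition monomial_ideal ::
    "('a, 'b) ring_scheme \<Rightarrow> (nat \<Rightarrow> 'a) \<Rightarrow> nat \<Rightarrow> 'a set \<Rightarrow> bool"
  where "monomial_ideal R x d I \<longleftrightarrow>
    I \<noteq> carrier R \<and> (\<exists>S. S \<subseteq> monomials R x d \<and> I = Idl\<^bsub>R\<^esub> S)"

definition squarefree_monomial_ideal ::
    "('a, 'b) ring_scheme \<Rightarrow> (nat \<Rightarrow> 'a) \<Rightarrow> nat \<Rightarrow> 'a set \<Rightarrow> bool"
  where "squarefree_monomial_ideal R x d I \<longleftrightarrow>
    I \<noteq> carrier R \<and> (\<exists>S. S \<subseteq> squarefree_monomials R x d \<and> I = Idl\<^bsub>R\<^esub> S)"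


section \<open>Associated primes\<close>

definition quot_module :: "('a, 'b) ring_scheme \<Rightarrow> 'a set \<Rightarrow> ('a, 'a set) module"
  where "quot_module R I =
    \<lparr>carrier = carrier (R Quot I), mult = mult (R Quot I), one = \<one>\<^bsub>R Quot I\<^esub>,
     zero = \<zero>\<^bsub>R Quot I\<^esub>, add = add (R Quot I),
     smult = (\<lambda>r A. (I +>\<^bsub>R\<^esub> r) \<otimes>\<^bsub>R Quot I\<^esub> A)\<rparr>"

definition Ass :: "('a, 'b) ring_scheme \<Rightarrow> ('a, 'c, 'd) module_scheme \<Rightarrow> 'a set set"
  where "Ass R M = {p. primeideal p R \<and>
    (\<exists>m\<in>carrier M. p = {r \<in> carrier R. r \<odot>\<^bsub>M\<^esub> m = \<zero>\<^bsub>M\<^esub>})}"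

definition mAss :: "('a, 'b) ring_scheme \<Rightarrow> ('a, 'c, 'd) module_scheme \<Rightarrow> 'a set set"
  where "mAss R M = {p \<in> Ass R M. \<forall>q\<in>Ass R M. q \<subseteq> p \<longrightarrow> q = p}"

lemma (in cring) module_quot_module:
  assumes "ideal I R"
  shows "module R (quot_module R I)"
proof -
  interpret I: ideal I R by (rule assms)
  interpret Q: ring "R Quot I" by (rule I.quotient_is_ring)
  have h: "I +> r \<in> carrier (R Quot I)" if "r \<in> carrier R" for r
    using that by (auto simp: FactRing_simps)
  have hom: "(+>) I \<in> ring_hom R (R Quot I)"
    by (rule I.rcos_ring_hom)
  have ag: "abelian_group (quot_module R I)"
    by (rule abelian_groupI)
       (auto simp: quot_module_def Q.add.m_ac intro: Q.add.l_inv_ex)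
  show ?thesis
    by (rule moduleI[OF is_cring ag])
       (auto simp: quot_module_def h Q.l_distr Q.r_distr Q.m_assoc
          ring_hom_add[OF hom] ring_hom_mult[OF hom] ring_hom_one[OF hom])
qed


section \<open>Primary decomposition and symbolic powers\<close>

definition primary_ideal :: "('a, 'b) ring_scheme \<Rightarrow> 'a set \<Rightarrow> bool"
  where "primary_ideal R q \<longleftrightarrow> ideal q R \<and> q \<noteq> carrier R \<and>
    (\<forall>a\<in>carrier R. \<forall>b\<in>carrier R. a \<otimes>\<^bsub>R\<^esub> b \<in> q \<longrightarrow> a \<in> q \<or> b \<in> radical R q)"

definition minimal_primary_decomposition ::
    "('a, 'b) ring_scheme \<Rightarrow> 'a set \<Rightarrow> 'a set set \<Rightarrow> bool"
  where "minimal_primary_decomposition R I Q \<longleftrightarrow>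
    finite Q \<and> (\<forall>q\<in>Q. primary_ideal R q) \<and>
    I = carrier R \<inter> \<Inter> Q \<and>
    inj_on (radical R) Q \<and>
    (\<forall>q\<in>Q. \<not> carrier R \<inter> \<Inter> (Q - {q}) \<subseteq> q)"

definition primary_component :: "('a, 'b) ring_scheme \<Rightarrow> 'a set \<Rightarrow> 'a set \<Rightarrow> bool"
  where "primary_component R I q \<longleftrightarrow> (\<exists>Q. minimal_primary_decomposition R I Q \<and> q \<in> Q)"

text \<open>
  The primes in \<open>mAss R (R/I)\<close> are minimal over \<open>I\<^sup>n\<close>, so for each of them all minimal primary
  decompositions of \<open>I\<^sup>n\<close> have the same component; no decomposition has to be chosen.
\<close>

definition symbolic_power :: "('a, 'b) ring_scheme \<Rightarrow> 'a set \<Rightarrow> nat \<Rightarrow> 'a set"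
  where "symbolic_power R I n = carrier R \<inter>
    \<Inter> {q. primary_component R (ideal_power R I n) q \<and> radical R q \<in> mAss R (quot_module R I)}"


section \<open>Integral closure\<close>

definition integral_closure :: "('a, 'b) ring_scheme \<Rightarrow> 'a set \<Rightarrow> 'a set"
  where "integral_closure R J = {x \<in> carrier R. \<exists>n\<ge>1. \<exists>c::nat \<Rightarrow> 'a.
    (\<forall>i\<in>{1..n}. c i \<in> ideal_power R J i) \<and>
    x [^]\<^bsub>R\<^esub> n \<oplus>\<^bsub>R\<^esub> (\<Oplus>\<^bsub>R\<^esub>i\<in>{1..n}. c i \<otimes>\<^bsub>R\<^esub> x [^]\<^bsub>R\<^esub> (n - i)) = \<zero>\<^bsub>R\<^esub>}"

definition integrally_closed :: "('a, 'b) ring_scheme \<Rightarrow> 'a set \<Rightarrow> bool"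
  where "integrally_closed R J \<longleftrightarrow> J = integral_closure R J"

definition normal_ideal :: "('a, 'b) ring_scheme \<Rightarrow> 'a set \<Rightarrow> bool"
  where "normal_ideal R J \<longleftrightarrow> (\<forall>n\<ge>1. integrally_closed R (ideal_power R J n))"

end

theory Submission
  imports Defs "HOL-Library.Function_Algebras"
begin

text \<open>
  Write \<open>P\<close> for the prime ideal generated by the regular sequence and \<open>gen U\<close> for the ideal generated
  by the monomials whose exponents lie in an up-set \<open>U \<subseteq> \<nat>\<^sup>d\<close>.  Since powers of the sequence are again
  regular in any order, \<open>a x\<^sup>e \<in> gen U\<close> with \<open>e \<notin> U\<close> forces \<open>a \<in> P\<close>.  Together with Krull's intersection
  theorem this shows that \<open>U \<mapsto> gen U\<close> commutes with arbitrary intersections, so every \<open>r\<close> has a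
  smallest up-set \<open>support r\<close> with \<open>r \<in> gen (support r)\<close>.  If \<open>e \<in> support r\<close> and \<open>f \<in> support s\<close> are such
  that \<open>e + f\<close> has no other decomposition, then primality of \<open>P\<close> makes the coefficient of
  \<open>x\<^bsup>e + f\<^esup>\<close> in \<open>r s\<close> survive.  Hence the ideals \<open>P\<^sub>A = (x\<^sub>i : i \<in> A)\<close> are prime, their powers are primary
  and their associated graded rings are domains, and localizing a monomial ideal at \<open>P\<^sub>A\<close> and
  contracting it gives a monomial ideal again.  Minimal primes of monomial ideals are of the form
  \<open>P\<^sub>A\<close>, squarefree monomial ideals are intersections of such primes, and \<open>P\<^sub>A\<^sup>n\<close> is integrally closed
  because the order with respect to \<open>P\<^sub>A\<close> is additive on products.
\<close>

text \<open>Coefficients lie in R and not in a field, so an expansion in monomials is not unique: a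
  coefficient in \<open>\<P>\<close> can be rewritten through larger monomials. Only coefficients at
  minimal exponents mean anything, and only modulo \<open>\<P>\<close>. Hence an element is measured
  by an up-set instead of a finite set of exponents, and primality of \<open>\<P>\<close> replaces
  the absence of zero divisors in a coefficient field. In a product several pairs of exponents may
  meet in one sum and cancel, so a pair with a unique sum is needed. It is found by minimizing the
  total degree in the variables of A and then each coordinate in turn; with this order the same
  choice serves the primality of P_A, the additivity of the order and the localization at P_A. The
  Jacobson radical acts only through Nakayama's lemma: it allows the sequence to be reordered, and
  it makes the filtration by total degree separated modulo every \<open>gen U\<close>. Quotients and
  localizations are replaced by relations between elements: r = j + a y for membership modulo an
  added generator, and s r in J with s outside P for localization.\<close>

locale noetherian_cring = cring R + noetherian_ring R for R (structure)

section \<open>Elementary ideal calculus: colon ideals and adjoining one generator\<close>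

lemmas ideal_add_closed = additive_subgroup.a_closed[OF ideal.axioms(1)]

lemma (in cring) power_diff_mem:
  assumes "ideal J R" "u \<in> carrier R" "v \<in> carrier R" "u \<ominus> v \<in> J"
  shows "u [^] (n::nat) \<ominus> v [^] n \<in> J"
proof (induction n)
  case 0
  then show ?case using assms(1) by (simp add: minus_eq r_neg additive_subgroup.zero_closed ideal.axioms(1))
next
  case (Suc n)
  interpret J: ideal J R by fact
  have "u [^] Suc n \<ominus> v [^] Suc n = (u [^] n \<ominus> v [^] n) \<otimes> u \<oplus> v [^] n \<otimes> (u \<ominus> v)"
    using assms(2,3) nat_pow_closed[of u n] nat_pow_closed[of v n] unfolding nat_pow_Suc by algebra
  then show ?case using Suc assms by (simp add: J.I_l_closed J.I_r_closed)
qed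

lemma (in cring) mem_ideal_diff_cancel:
  assumes "ideal J R" "u \<in> carrier R" "v \<in> J" "u \<ominus> v \<in> J"
  shows "u \<in> J"
proof -
  interpret J: ideal J R by fact
  have "v \<in> carrier R" using assms(3) J.Icarr by blast
  then have "u = (u \<ominus> v) \<oplus> v" using assms(2) by algebra
  then show ?thesis using assms J.a_closed by metis
qed

lemma (in cring) ideal_add_cancel:
  assumes "ideal J R" "j \<in> J" "u \<in> carrier R" "j \<oplus> u \<in> J"
  shows "u \<in> J"
proof -
  have "j \<in> carrier R" using assms(1,2) ideal.Icarr by metis
  then have "u = (j \<oplus> u) \<oplus> \<ominus> j" using assms(3) by algebra
  then show ?thesis
    using ideal_add_closed[OF assms(1,4)] additive_subgroup.a_inv_closed[OF ideal.axioms(1)] assms(1,2)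
    by metis
qed

lemma (in cring) colon_ideal:
  assumes "ideal J R" "a \<in> carrier R"
  shows "ideal {r \<in> carrier R. a \<otimes> r \<in> J} R"
  using ideal.helper_max_prime[OF assms(1) is_cring assms(2)] .

text \<open>The elements that \<open>a\<close> multiplies into J form an ideal, so it is enough to
  test generators.\<close>

lemma (in cring) genideal_mult_mem:
  assumes "S \<subseteq> carrier R" "ideal J R" "a \<in> carrier R" "r \<in> Idl S"
    and "\<And>s. s \<in> S \<Longrightarrow> a \<otimes> s \<in> J"
  shows "a \<otimes> r \<in> J"
proof -
  have "Idl S \<subseteq> {r \<in> carrier R. a \<otimes> r \<in> J}"
    using assms by (intro genideal_minimal colon_ideal) auto
  then show ?thesis using assms(4) by auto
qed

lemma (in cring) genideal_mult_mem2:
  assumes "S \<subseteq> carrier R" "T \<subseteq> carrier R" "ideal J R" "a \<in> Idl S" "b \<in> Idl T"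
    and "\<And>s t. s \<in> S \<Longrightarrow> t \<in> T \<Longrightarrow> s \<otimes> t \<in> J"
  shows "a \<otimes> b \<in> J"
proof (rule genideal_mult_mem[OF assms(2,3) _ assms(5)])
  show a: "a \<in> carrier R" using assms(4) genideal_ideal[OF assms(1)] ideal.Icarr by metis
  fix t assume t: "t \<in> T"
  then have tc: "t \<in> carrier R" using assms(2) by auto
  have "t \<otimes> a \<in> J"
  proof (rule genideal_mult_mem[OF assms(1,3) tc assms(4)])
    fix s assume s: "s \<in> S"
    then show "t \<otimes> s \<in> J" using assms(1,6) t tc by (metis m_comm subsetD)
  qed
  then show "a \<otimes> t \<in> J" using a tc m_comm by simp
qed

text \<open>The generated ideal is the sum of J and a principal ideal. This explicit form carries
  all later computations modulo a growing sequence of generators.\<close>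

lemma (in cring) mem_genideal_insert:
  assumes "ideal J R" "y \<in> carrier R"
  shows "r \<in> Idl (insert y J) \<longleftrightarrow> (\<exists>j\<in>J. \<exists>a\<in>carrier R. r = j \<oplus> a \<otimes> y)"
proof -
  interpret J: ideal J R by fact
  have *: "Idl {y} = PIdl y" using cgenideal_eq_genideal[OF assms(2)] by simp
  have c: "J \<union> PIdl y \<subseteq> carrier R"
    using J.a_subset cgenideal_ideal[OF assms(2)] by (auto dest: ideal.Icarr)
  have i: "ideal (Idl (insert y J)) R" using assms J.a_subset by (intro genideal_ideal) auto
  have s: "insert y J \<subseteq> Idl (insert y J)" using assms J.a_subset by (intro genideal_self) auto
  have "Idl (insert y J) = Idl (J \<union> PIdl y)"
  proof (rule equalityI)
    show "Idl (insert y J) \<subseteq> Idl (J \<union> PIdl y)"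
      using cgenideal_self[OF assms(2)] by (intro subset_Idl_subset[OF c]) auto
    show "Idl (J \<union> PIdl y) \<subseteq> Idl (insert y J)"
      using s by (intro genideal_minimal[OF i] Un_least cgenideal_minimal[OF i]) auto
  qed
  then show ?thesis
    unfolding union_genideal[OF assms(1) cgenideal_ideal[OF assms(2)]]
    by (auto simp: set_add_def' cgenideal_def)
qed

lemma (in cring) genideal_insert_ideal:
  assumes "ideal J R" "y \<in> carrier R"
  shows "ideal (Idl (insert y J)) R" "J \<subseteq> Idl (insert y J)" "y \<in> Idl (insert y J)"
proof -
  interpret J: ideal J R by fact
  have c: "insert y J \<subseteq> carrier R" using assms(2) J.a_subset by auto
  show "ideal (Idl (insert y J)) R" by (rule genideal_ideal[OF c])
  show "J \<subseteq> Idl (insert y J)" "y \<in> Idl (insert y J)" using genideal_self[OF c] by auto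
qed

lemma (in cring) genideal_insert_genideal:
  assumes "S \<subseteq> carrier R" "y \<in> carrier R"
  shows "Idl (insert y (Idl S)) = Idl (insert y S)"
proof (rule equalityI)
  have c: "insert y S \<subseteq> carrier R" using assms by auto
  have i: "ideal (Idl (insert y S)) R" by (rule genideal_ideal[OF c])
  have "S \<subseteq> Idl (insert y S)" "y \<in> Idl (insert y S)" using genideal_self[OF c] by auto
  then show "Idl (insert y (Idl S)) \<subseteq> Idl (insert y S)"
    by (intro genideal_minimal[OF i]) (simp add: genideal_minimal[OF i])
  show "Idl (insert y S) \<subseteq> Idl (insert y (Idl S))"
    using genideal_self[OF assms(1)] genideal_insert_ideal[OF genideal_ideal[OF assms(1)] assms(2)]
    by (intro genideal_minimal) auto
qed

subsection \<open>Radicals\<close>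

lemma radicalI:
  assumes "a \<in> carrier R" "a [^]\<^bsub>R\<^esub> n \<in> J" "n \<ge> (1::nat)"
  shows "a \<in> radical R J"
  using assms unfolding radical_def by blast

lemma radicalE:
  assumes "a \<in> radical R J"
  obtains n :: nat where "n \<ge> 1" "a [^]\<^bsub>R\<^esub> n \<in> J" "a \<in> carrier R"
  using assms unfolding radical_def by blast

lemma (in cring) radical_ideal:
  assumes "ideal J R"
  shows "ideal (radical R J) R"
proof -
  interpret J: ideal J R by fact
  have pow: "u [^] (m * n :: nat) = (u [^] m) [^] n" if "u \<in> carrier R" for u m n
    using that by (simp add: nat_pow_pow)
  have l: "x \<otimes> a \<in> radical R J" if "a \<in> radical R J" "x \<in> carrier R" for a x
    using that by (auto simp: radical_def nat_pow_distrib intro: J.I_l_closed)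
  have add: "a \<oplus> b \<in> radical R J" if rab: "a \<in> radical R J" "b \<in> radical R J" for a b
  proof -
    obtain n :: nat where n: "n \<ge> 1" "a [^] n \<in> J" "a \<in> carrier R" using rab(1) by (rule radicalE)
    obtain m :: nat where m: "m \<ge> 1" "b [^] m \<in> J" "b \<in> carrier R" using rab(2) by (rule radicalE)
    note nm = n(1,2) m(1,2) and ab = n(3) m(3)
    \<comment> \<open>This avoids the binomial theorem: (a + b)^m is congruent to b^m modulo
      \<open>a\<close>, so it equals b^m + t a, and its n-th power is congruent to (t a)^n modulo J,
      which lies in J.\<close>
    have "(a \<oplus> b) [^] m \<ominus> b [^] m \<in> PIdl a"
    proof (rule power_diff_mem[OF cgenideal_ideal])
      have "a \<oplus> b \<ominus> b = a" using ab by algebra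
      then show "a \<oplus> b \<ominus> b \<in> PIdl a" using ab cgenideal_self by simp
    qed (use ab in auto)
    then obtain t where t: "t \<in> carrier R" "(a \<oplus> b) [^] m \<ominus> b [^] m = t \<otimes> a"
      by (auto simp: cgenideal_def)
    have "(a \<oplus> b) [^] m \<ominus> t \<otimes> a = b [^] m"
    proof -
      have "(a \<oplus> b) [^] m \<ominus> ((a \<oplus> b) [^] m \<ominus> b [^] m) = b [^] m"
        using ab nat_pow_closed[of "a \<oplus> b" m] nat_pow_closed[of b m] by algebra
      then show ?thesis using t by simp
    qed
    then have 1: "((a \<oplus> b) [^] m) [^] n \<ominus> (t \<otimes> a) [^] n \<in> J"
      using ab t nm by (intro power_diff_mem[OF assms]) auto
    have 2: "(t \<otimes> a) [^] n \<in> J" using ab t nm by (simp add: nat_pow_distrib J.I_l_closed)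
    have "((a \<oplus> b) [^] m) [^] n \<in> J"
      by (rule mem_ideal_diff_cancel[OF assms _ 2 1]) (use ab in simp)
    then have "(a \<oplus> b) [^] (m * n) \<in> J" using ab by (simp add: pow)
    then show ?thesis using ab nm by (auto simp: radical_def intro!: exI[of _ "m * n"])
  qed
  have z: "\<zero> \<in> radical R J" by (auto simp: radical_def nat_pow_zero intro!: exI[of _ 1])
  have sub: "radical R J \<subseteq> carrier R" by (auto simp: radical_def)
  show ?thesis
  proof (rule idealI[OF ring_axioms])
    show "subgroup (radical R J) (add_monoid R)"
    proof (rule add.subgroupI)
      fix a assume a: "a \<in> radical R J"
      then have "\<ominus> \<one> \<otimes> a \<in> radical R J" by (intro l) auto
      then show "\<ominus> a \<in> radical R J" using a sub by (simp add: l_minus subset_iff)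
    qed (use sub z add in auto)
    fix a x assume "a \<in> radical R J" "x \<in> carrier R"
    then show "x \<otimes> a \<in> radical R J" "a \<otimes> x \<in> radical R J"
      using l sub m_comm by (auto simp: subset_iff)
  qed
qed

lemma (in cring) subset_radical:
  assumes "ideal J R"
  shows "J \<subseteq> radical R J"
proof
  interpret J: ideal J R by fact
  fix a assume "a \<in> J"
  then show "a \<in> radical R J" using J.Icarr by (auto simp: radical_def intro!: exI[of _ 1])
qed

lemma (in cring) primeideal_powerD:
  assumes "primeideal P R" "a \<in> carrier R" "a [^] (n::nat) \<in> P"
  shows "a \<in> P"
  using assms(3)
proof (induction n)
  case 0
  interpret P: primeideal P R by fact
  show ?case using 0 P.one_imp_carrier P.I_notcarr by simp
next
  case (Suc n)
  then show ?case using primeideal.I_prime[OF assms(1), of "a [^] n" a] assms(2) by auto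
qed

lemma (in cring) radical_subset_primeideal:
  assumes "primeideal P R" "J \<subseteq> P"
  shows "radical R J \<subseteq> P"
  using primeideal_powerD[OF assms(1)] assms(2) by (auto simp: radical_def)

lemma (in cring) primary_radical_primeideal:
  assumes "primary_ideal R q"
  shows "primeideal (radical R q) R"
proof (rule primeidealI)
  have q: "ideal q R" "q \<noteq> carrier R" using assms by (auto simp: primary_ideal_def)
  show "ideal (radical R q) R" by (rule radical_ideal[OF q(1)])
  show "cring R" by (rule is_cring)
  have "\<one> \<notin> radical R q" using q ideal.one_imp_carrier[OF q(1)] by (auto simp: radical_def)
  then show "carrier R \<noteq> radical R q" using one_closed by metis
  fix a b assume ab: "a \<in> carrier R" "b \<in> carrier R" "a \<otimes> b \<in> radical R q"
  then obtain n :: nat where n: "n \<ge> 1" "a [^] n \<otimes> b [^] n \<in> q"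
    by (auto simp: radical_def nat_pow_distrib)
  then have "a [^] n \<in> q \<or> b [^] n \<in> radical R q" using assms ab by (auto simp: primary_ideal_def)
  then show "a \<in> radical R q \<or> b \<in> radical R q"
  proof
    assume "a [^] n \<in> q" then show ?thesis using n ab by (auto simp: radical_def)
  next
    assume "b [^] n \<in> radical R q"
    then obtain m :: nat where "m \<ge> 1" "(b [^] n) [^] m \<in> q" by (auto simp: radical_def)
    then have "b [^] (n * m) \<in> q" using ab by (simp add: nat_pow_pow)
    then show ?thesis using ab n \<open>m \<ge> 1\<close> by (auto simp: radical_def intro!: exI[of _ "n*m"])
  qed
qed

text \<open>If each ideal had an element outside P, the product of these elements would lie in the
  intersection but not in P. The factor \<open>carrier R\<close> gives the empty family the
  intersection R.\<close>

lemma (in cring) primeideal_Inter_finite: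
  assumes "primeideal P R" "finite Q" "\<And>q. q \<in> Q \<Longrightarrow> ideal q R" "carrier R \<inter> \<Inter> Q \<subseteq> P"
  shows "\<exists>q\<in>Q. q \<subseteq> P"
  using assms(2-4)
proof (induction Q)
  case empty
  interpret P: primeideal P R by fact
  show ?case using empty P.I_notcarr P.a_subset by auto
next
  case (insert q Q)
  interpret P: primeideal P R by fact
  interpret q: ideal q R using insert by auto
  show ?case
  proof (rule ccontr)
    assume n: "\<not> ?case"
    then obtain a where a: "a \<in> q" "a \<notin> P" by auto
    have "\<not> carrier R \<inter> \<Inter> Q \<subseteq> P" using insert n by auto
    then obtain b where b: "b \<in> carrier R" "\<And>q'. q' \<in> Q \<Longrightarrow> b \<in> q'" "b \<notin> P" by auto
    have ac: "a \<in> carrier R" using a q.Icarr by auto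
    have "a \<otimes> b \<in> q'" if "q' \<in> insert q Q" for q'
      using that insert.prems(1)[OF that] a b ac
      by (auto intro: ideal.I_l_closed ideal.I_r_closed)
    then have "a \<otimes> b \<in> P" using insert.prems(2) ac b by auto
    then show False using P.I_prime[of a b] a b ac by blast
  qed
qed

lemma (in cring) Inter_ideal:
  assumes "\<And>q. q \<in> Q \<Longrightarrow> ideal q R"
  shows "ideal (carrier R \<inter> \<Inter> Q) R"
proof -
  have "ideal (\<Inter> (insert (carrier R) Q)) R" using assms oneideal by (intro i_Intersect) auto
  then show ?thesis by simp
qed

subsection \<open>Ideals of a Noetherian ring\<close>

lemma (in noetherian_ring) exists_maximal_ideal_in:
  assumes "\<S> \<noteq> {}" "\<And>I. I \<in> \<S> \<Longrightarrow> ideal I R"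
  shows "\<exists>M\<in>\<S>. \<forall>L\<in>\<S>. M \<subseteq> L \<longrightarrow> L = M"
proof (rule subset_Zorn_nonempty[OF assms(1)])
  fix C assume C: "C \<noteq> {}" "subset.chain \<S> C"
  then have "subset.chain {I. ideal I R} C" using assms(2) by (auto simp: subset_chain_def)
  then have "\<Union>C \<in> C" using ideal_chain_is_trivial C by blast
  then show "\<Union>C \<in> \<S>" using C by (auto simp: subset_chain_def)
qed

lemma (in noetherian_ring) noetherian_induct [consumes 1, case_names step]:
  assumes "ideal I R"
    and "\<And>I. ideal I R \<Longrightarrow> (\<And>J. ideal J R \<Longrightarrow> I \<subset> J \<Longrightarrow> P J) \<Longrightarrow> P I"
  shows "P I"
proof (rule ccontr)
  assume "\<not> P I"
  then have "\<exists>M\<in>{I. ideal I R \<and> \<not> P I}. \<forall>L\<in>{I. ideal I R \<and> \<not> P I}. M \<subseteq> L \<longrightarrow> L = M"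
    using assms(1) by (intro exists_maximal_ideal_in) auto
  then show False using assms(2) by blast
qed

text \<open>Noetherian induction that does not pass through irreducible ideals: if a b is in J, a is
  not in J and no power of b is in J, then J is the intersection of (J : b^n) and J + b^n R for
  suitable n, and both are strictly larger.\<close>

lemma (in noetherian_cring) primary_decomposition:
  assumes "ideal J R"
  shows "\<exists>Q. finite Q \<and> (\<forall>q\<in>Q. primary_ideal R q) \<and> J = carrier R \<inter> \<Inter> Q"
  using assms
proof (induction rule: noetherian_induct)
  case (step J)
  interpret J: ideal J R by fact
  show ?case
  proof (cases "J = carrier R \<or> primary_ideal R J")
    case True
    then show ?thesis
    proof
      assume "J = carrier R" then show ?thesis by (intro exI[of _ "{}"]) auto
    next
      assume "primary_ideal R J" then show ?thesis using J.a_subset by (intro exI[of _ "{J}"]) auto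
    qed
  next
    case False
    then obtain a b where ab: "a \<in> carrier R" "b \<in> carrier R" "a \<otimes> b \<in> J" "a \<notin> J" "b \<notin> radical R J"
      using step.hyps by (auto simp: primary_ideal_def)
    define c where "c n = {r \<in> carrier R. b [^] n \<otimes> r \<in> J}" for n :: nat
    have ci: "ideal (c n) R" for n unfolding c_def using ab by (intro colon_ideal step) auto
    \<comment> \<open>Stationarity of the chain (J : b^n), used below only as (J : b^2n) = (J :
      b^n). The restriction n >= 1 ensures that b^n is outside J and that \<open>a\<close> lies in
      (J : b^n).\<close>
    have "\<exists>M\<in>c ` {1..}. \<forall>L\<in>c ` {1..}. M \<subseteq> L \<longrightarrow> L = M"
      using ci by (intro exists_maximal_ideal_in) auto
    then obtain n where n: "n \<ge> 1" "\<And>m. m \<ge> 1 \<Longrightarrow> c n \<subseteq> c m \<Longrightarrow> c m = c n" by fastforce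
    have "c n \<subseteq> c (n + n)"
      using ab by (auto simp: c_def nat_pow_mult[symmetric] m_assoc J.I_l_closed)
    then have c2: "c (n + n) = c n" using n by auto
    define b' where "b' = b [^] n"
    have b': "b' \<in> carrier R" "b' \<notin> J" using ab n by (auto simp: b'_def radical_def)
    let ?K = "Idl (insert b' J)"
    have K: "ideal ?K R" "J \<subseteq> ?K" "b' \<in> ?K"
      using genideal_insert_ideal[OF step.hyps b'(1)] by auto
    have "J \<subseteq> c n" using b' J.Icarr by (auto simp: c_def b'_def intro: J.I_l_closed)
    moreover have "a \<in> c n"
    proof -
      obtain m where m: "n = Suc m" using n by (cases n) auto
      have "b [^] n \<otimes> a = b [^] m \<otimes> (a \<otimes> b)" using ab m by (simp add: m_ac)
      then show ?thesis using ab by (simp add: c_def J.I_l_closed)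
    qed
    ultimately have "J \<subset> c n" using ab by auto
    from step.IH[OF ci this]
    obtain Q1 where Q1: "finite Q1" "\<forall>q\<in>Q1. primary_ideal R q" "c n = carrier R \<inter> \<Inter> Q1"
      by blast
    have "J \<subset> ?K" using K b' by auto
    from step.IH[OF K(1) this]
    obtain Q2 where Q2: "finite Q2" "\<forall>q\<in>Q2. primary_ideal R q" "?K = carrier R \<inter> \<Inter> Q2"
      by blast
    \<comment> \<open>If y = j + r b^n and b^n y is in J, then b^2n r is in J, hence b^n r is in J
      by stationarity, and so is y.\<close>
    have "J = c n \<inter> ?K"
    proof (intro equalityI subsetI)
      fix y assume "y \<in> J" then show "y \<in> c n \<inter> ?K" using \<open>J \<subset> c n\<close> K by auto
    next
      fix y assume y: "y \<in> c n \<inter> ?K"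
      then have "y \<in> ?K" by simp
      then obtain j r where jr: "j \<in> J" "r \<in> carrier R" "y = j \<oplus> r \<otimes> b'"
        unfolding mem_genideal_insert[OF step.hyps b'(1)] by blast
      have jc: "j \<in> carrier R" using jr J.Icarr by auto
      have 1: "b' \<otimes> j \<oplus> b' \<otimes> (b' \<otimes> r) \<in> J"
      proof -
        have "b' \<otimes> y \<in> J" using y by (simp add: c_def b'_def)
        moreover have "b' \<otimes> y = b' \<otimes> j \<oplus> b' \<otimes> (b' \<otimes> r)"
          unfolding jr using jr(2) jc b'(1) by algebra
        ultimately show ?thesis by simp
      qed
      have "b' \<otimes> (b' \<otimes> r) \<in> J"
        by (rule ideal_add_cancel[OF step.hyps _ _ 1])
          (use jr b' in \<open>simp_all add: ideal.I_l_closed[OF step.hyps]\<close>)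
      then have "r \<in> c (n + n)"
        using jr ab by (simp add: c_def b'_def nat_pow_mult[symmetric] m_assoc)
      then have "b' \<otimes> r \<in> J" unfolding c2 by (simp add: c_def b'_def)
      then show "y \<in> J" using jr b' m_comm by simp
    qed
    then have "J = carrier R \<inter> \<Inter> (Q1 \<union> Q2)" unfolding Q1(3) Q2(3) by auto
    then show ?thesis using Q1(1,2) Q2(1,2) by (intro exI[of _ "Q1 \<union> Q2"]) auto
  qed
qed

lemma (in cring) primary_ideal_Int:
  assumes "primary_ideal R q" "primary_ideal R q'" "radical R q = radical R q'"
  shows "primary_ideal R (q \<inter> q')" "radical R (q \<inter> q') = radical R q"
proof -
  have q: "ideal q R" "ideal q' R" using assms by (auto simp: primary_ideal_def)
  show r: "radical R (q \<inter> q') = radical R q"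
  proof (intro equalityI subsetI)
    fix a assume "a \<in> radical R (q \<inter> q')" then show "a \<in> radical R q" by (auto simp: radical_def)
  next
    fix a assume a: "a \<in> radical R q"
    then have "a \<in> radical R q'" using assms by simp
    with a obtain n m :: nat where nm: "n \<ge> 1" "a [^] n \<in> q" "a [^] m \<in> q'" and ac: "a \<in> carrier R"
      by (auto simp: radical_def)
    have "a [^] (n + m) \<in> q \<inter> q'"
      unfolding nat_pow_mult[OF ac, symmetric] using nm ac q
      by (auto intro: ideal.I_l_closed ideal.I_r_closed)
    then show "a \<in> radical R (q \<inter> q')" using ac nm by (auto simp: radical_def intro!: exI[of _ "n+m"])
  qed
  have "q \<inter> q' \<noteq> carrier R" using assms ideal.Icarr[OF q(1)] by (auto simp: primary_ideal_def)
  then show "primary_ideal R (q \<inter> q')"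
    unfolding primary_ideal_def r using i_intersect[OF q] assms
    by (auto simp: primary_ideal_def)
qed

text \<open>A decomposition with the fewest components is minimal: merging two components with equal
  radical or dropping a redundant one would shorten it.\<close>

lemma (in noetherian_cring) minimal_primary_decomposition_exists:
  assumes "ideal J R"
  shows "\<exists>Q. minimal_primary_decomposition R J Q"
proof -
  define D where "D Q \<longleftrightarrow> finite Q \<and> (\<forall>q\<in>Q. primary_ideal R q) \<and> J = carrier R \<inter> \<Inter> Q" for Q
  obtain Q where Q: "D Q" and min: "\<And>Q'. D Q' \<Longrightarrow> card Q \<le> card Q'"
    using primary_decomposition[OF assms] ex_has_least_nat[of D _ card] unfolding D_def by metis
  have fin: "finite Q" and prim: "\<And>q. q \<in> Q \<Longrightarrow> primary_ideal R q" and JQ: "J = carrier R \<inter> \<Inter> Q"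
    using Q by (auto simp: D_def)
  have "inj_on (radical R) Q"
  proof (rule inj_onI, rule ccontr)
    fix q q' assume q: "q \<in> Q" "q' \<in> Q" "radical R q = radical R q'" "q \<noteq> q'"
    let ?Q = "insert (q \<inter> q') (Q - {q, q'})"
    have "D ?Q" unfolding D_def using fin prim primary_ideal_Int(1)[OF prim prim] q JQ by auto
    then have "card Q \<le> card ?Q" by (rule min)
    also have "\<dots> \<le> Suc (card (Q - {q, q'}))" by (rule card_insert_le_m1) auto
    also have "\<dots> < card Q"
    proof -
      have "card (Q - {q, q'}) = card Q - 2" using q fin by (simp add: card_Diff_subset)
      moreover have "card {q, q'} \<le> card Q" using q fin by (intro card_mono) auto
      ultimately show ?thesis using q by simp
    qed
    finally show False by simp
  qed
  moreover have "\<not> carrier R \<inter> \<Inter> (Q - {q}) \<subseteq> q" if q: "q \<in> Q" for q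
  proof
    assume a: "carrier R \<inter> \<Inter> (Q - {q}) \<subseteq> q"
    have "carrier R \<inter> \<Inter> (Q - {q}) = J" unfolding JQ using a q by auto
    then have "D (Q - {q})" unfolding D_def using fin prim by auto
    then have "card Q \<le> card (Q - {q})" by (rule min)
    then show False using card_Diff1_less[OF fin q] by simp
  qed
  ultimately show ?thesis using fin prim JQ by (auto simp: minimal_primary_decomposition_def)
qed

text \<open>A proper ideal \<open>L\<close> that is maximal among those between \<open>J\<close> and \<open>K\<close> makes \<open>K / L\<close> simple,
  so a maximal ideal annihilates it.\<close>

lemma (in noetherian_cring) nakayama:
  assumes J: "ideal J R" and K: "ideal K R" and P: "P \<subseteq> jacobson_radical R"
    and H: "\<And>L. ideal L R \<Longrightarrow> J \<subseteq> L \<Longrightarrow> (\<And>p k. p \<in> P \<Longrightarrow> k \<in> K \<Longrightarrow> p \<otimes> k \<in> L) \<Longrightarrow> K \<subseteq> L"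
    and JK: "J \<subseteq> K"
  shows "K \<subseteq> J"
proof (rule ccontr)
  assume "\<not> K \<subseteq> J"
  let ?S = "{L. ideal L R \<and> J \<subseteq> L \<and> L \<subset> K}"
  have "\<exists>L\<in>?S. \<forall>L'\<in>?S. L \<subseteq> L' \<longrightarrow> L' = L"
    using J JK \<open>\<not> K \<subseteq> J\<close> by (intro exists_maximal_ideal_in) auto
  then obtain L where "L \<in> ?S" and mx0: "\<forall>L'\<in>?S. L \<subseteq> L' \<longrightarrow> L' = L" by (rule bexE)
  then have L: "ideal L R" "J \<subseteq> L" "L \<subset> K" by simp_all
  have mx: "L' = L" if "ideal L' R" "L \<subseteq> L'" "L' \<subset> K" for L'
    using mx0 that L(2) by blast
  have gen: "Idl (insert z L) = K" if z: "z \<in> K" "z \<notin> L" for z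
  proof -
    have zc: "z \<in> carrier R" using z ideal.Icarr[OF K] by auto
    have "Idl (insert z L) \<subseteq> K" using L z by (intro genideal_minimal[OF K]) auto
    then show ?thesis
      using mx[OF genideal_insert_ideal(1,2)[OF L(1) zc]] genideal_insert_ideal(3)[OF L(1) zc] z by auto
  qed
  obtain y where y: "y \<in> K" "y \<notin> L" using L by auto
  have yc: "y \<in> carrier R" using y ideal.Icarr[OF K] by auto
  \<comment> \<open>The annihilator of y in K / L. For r outside it, y r generates K modulo L as
    well, so y = l + s y r and 1 - s r annihilates y; this is the maximality of
    \<open>m\<close>.\<close>
  define m where "m = {r \<in> carrier R. y \<otimes> r \<in> L}"
  have m: "ideal m R" unfolding m_def by (rule colon_ideal[OF L(1) yc])
  have "\<one> \<notin> m" using y yc by (auto simp: m_def)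
  have "maximalideal m R"
  proof (rule maximalidealI[OF m])
    show "carrier R \<noteq> m" using \<open>\<one> \<notin> m\<close> by auto
    fix m' assume m': "ideal m' R" "m \<subseteq> m'" "m' \<subseteq> carrier R"
    show "m' = m \<or> m' = carrier R"
    proof (rule disjCI)
      assume "m' \<noteq> carrier R"
      show "m' = m"
      proof (rule ccontr)
        assume "m' \<noteq> m"
        then obtain r where r: "r \<in> m'" "r \<notin> m" using m' by auto
        have rc: "r \<in> carrier R" using r m' by auto
        have yrc: "y \<otimes> r \<in> carrier R" using rc yc by simp
        have "y \<otimes> r \<in> K" "y \<otimes> r \<notin> L" using r y rc ideal.I_r_closed[OF K] by (simp_all add: m_def)
        then have "y \<in> Idl (insert (y \<otimes> r) L)" using gen y by auto
        then obtain l s where ls: "l \<in> L" "s \<in> carrier R" "y = l \<oplus> s \<otimes> (y \<otimes> r)"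
          unfolding mem_genideal_insert[OF L(1) yrc] by blast
        have lc: "l \<in> carrier R" using ls ideal.Icarr[OF L(1)] by auto
        have "y \<otimes> (\<one> \<ominus> s \<otimes> r) = y \<ominus> s \<otimes> (y \<otimes> r)" using yc rc ls by algebra
        also have "\<dots> = l \<oplus> s \<otimes> (y \<otimes> r) \<ominus> s \<otimes> (y \<otimes> r)" using ls(3) by simp
        also have "\<dots> = l" using yc rc ls(2) lc by algebra
        finally have "\<one> \<ominus> s \<otimes> r \<in> m" using ls(1,2) rc by (simp add: m_def)
        then have 1: "\<one> \<ominus> s \<otimes> r \<in> m'" using m'(2) by auto
        have "\<one> \<in> m'"
          by (rule mem_ideal_diff_cancel[OF m'(1) one_closed ideal.I_l_closed[OF m'(1) r(1) ls(2)] 1])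
        then show False using ideal.one_imp_carrier[OF m'(1)] \<open>m' \<noteq> carrier R\<close> by simp
      qed
    qed
  qed
  then have Pm: "P \<subseteq> m" using P by (auto simp: jacobson_radical_def)
  have "K \<subseteq> L"
  \<comment> \<open>\<open>H\<close> expresses K = J + P K without forming the sum: K lies in every
    ideal that contains J and P K. Here L is such an ideal, because K = L + y R and P y lies in
    L.\<close>
  proof (rule H[OF L(1,2)])
    fix p k assume p: "p \<in> P" and k: "k \<in> K"
    have pc: "p \<in> carrier R" and py: "y \<otimes> p \<in> L" using p Pm by (auto simp: m_def)
    obtain l t where lt: "l \<in> L" "t \<in> carrier R" "k = l \<oplus> t \<otimes> y"
      using k unfolding gen[OF y, symmetric] mem_genideal_insert[OF L(1) yc] by blast
    have "p \<otimes> k = p \<otimes> l \<oplus> t \<otimes> (y \<otimes> p)"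
      unfolding lt(3) using lt(2) pc yc ideal.Icarr[OF L(1) lt(1)] by algebra
    then show "p \<otimes> k \<in> L" using lt pc py by (simp add: ideal.I_l_closed[OF L(1)] ideal_add_closed[OF L(1)])
  qed
  then show False using L by auto
qed

subsection \<open>Associated primes and symbolic powers\<close>

text \<open>Annihilators of cosets become colon ideals in R, so the quotient module need not be
  opened again.\<close>

lemma (in cring) Ass_quot_module_iff:
  assumes "ideal J R"
  shows "p \<in> Ass R (quot_module R J) \<longleftrightarrow>
    primeideal p R \<and> (\<exists>y\<in>carrier R. p = {r \<in> carrier R. y \<otimes> r \<in> J})"
proof -
  have "(J +> r) \<otimes>\<^bsub>R Quot J\<^esub> (J +> y) = J \<longleftrightarrow> y \<otimes> r \<in> J"
    if "r \<in> carrier R" "y \<in> carrier R" for r y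
  proof -
    have "(J +> r) \<otimes>\<^bsub>R Quot J\<^esub> (J +> y) = J +> (r \<otimes> y)"
      using ring_hom_mult[OF ideal.rcos_ring_hom[OF assms] that] by simp
    moreover have "J +> (r \<otimes> y) = J \<longleftrightarrow> r \<otimes> y \<in> J"
      using ideal.rcos_const_imp_mem[OF assms] a_rcos_zero[OF assms] that by (meson m_closed)
    ultimately show ?thesis using m_comm that by simp
  qed
  then have "{r \<in> carrier R. (J +> r) \<otimes>\<^bsub>R Quot J\<^esub> (J +> y) = J} = {r \<in> carrier R. y \<otimes> r \<in> J}"
    if "y \<in> carrier R" for y using that by auto
  moreover have "carrier (quot_module R J) = (\<lambda>y. J +> y) ` carrier R"
    by (auto simp: quot_module_def FactRing_def A_RCOSETS_def')
  ultimately show ?thesis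
    by (auto simp: Ass_def quot_module_def FactRing_def)
qed

lemma (in cring) Ass_quot_moduleD:
  assumes "ideal J R" "p \<in> Ass R (quot_module R J)"
  shows "primeideal p R" "J \<subseteq> p"
proof -
  from assms obtain y where y: "primeideal p R" "y \<in> carrier R" "p = {r \<in> carrier R. y \<otimes> r \<in> J}"
    by (auto simp: Ass_quot_module_iff)
  then show "primeideal p R" "J \<subseteq> p"
    using ideal.I_l_closed[OF assms(1)] ideal.Icarr[OF assms(1)] by auto
qed

text \<open>Let K be the intersection of the other components. For y in K outside q, (J : y) lies in
  the radical of q because q is primary; equality is reached when (J : y) is maximal among these
  colon ideals.\<close>

lemma (in noetherian_cring) radical_primary_component_in_Ass:
  assumes Q: "minimal_primary_decomposition R J Q" and q: "q \<in> Q"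
  shows "radical R q \<in> Ass R (quot_module R J)"
proof -
  have prim: "primary_ideal R q'" if "q' \<in> Q" for q'
    using Q that by (auto simp: minimal_primary_decomposition_def)
  then have idl: "ideal q' R" if "q' \<in> Q" for q' using that by (auto simp: primary_ideal_def)
  have J: "J = carrier R \<inter> \<Inter> Q" using Q by (auto simp: minimal_primary_decomposition_def)
  have iJ: "ideal J R" unfolding J using idl by (rule Inter_ideal)
  define K where "K = carrier R \<inter> \<Inter> (Q - {q})"
  have iK: "ideal K R" unfolding K_def by (intro Inter_ideal idl) auto
  have JK: "J = K \<inter> q" unfolding J K_def using q by auto
  have "\<not> K \<subseteq> q" using Q q by (auto simp: minimal_primary_decomposition_def K_def)
  define ann where "ann y = {r \<in> carrier R. y \<otimes> r \<in> J}" for y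
  have Kc: "y \<in> carrier R" if "y \<in> K" for y using that by (simp add: K_def)
  have "\<exists>M\<in>ann ` (K - q). \<forall>L\<in>ann ` (K - q). M \<subseteq> L \<longrightarrow> L = M"
  proof (rule exists_maximal_ideal_in)
    show "ann ` (K - q) \<noteq> {}" using \<open>\<not> K \<subseteq> q\<close> by auto
    show "ideal I R" if "I \<in> ann ` (K - q)" for I
      using that Kc unfolding ann_def by (auto intro: colon_ideal[OF iJ])
  qed
  then obtain y where y: "y \<in> K" "y \<notin> q"
    and mx: "\<And>z. z \<in> K \<Longrightarrow> z \<notin> q \<Longrightarrow> ann y \<subseteq> ann z \<Longrightarrow> ann z = ann y" by auto
  have yc: "y \<in> carrier R" using y Kc by auto
  have "ann y = radical R q"
  proof (intro equalityI subsetI)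
    fix r assume "r \<in> ann y"
    then have "y \<otimes> r \<in> q" "r \<in> carrier R" unfolding ann_def JK by auto
    then show "r \<in> radical R q" using prim[OF q] y yc by (auto simp: primary_ideal_def)
  next
    fix a assume "a \<in> radical R q"
    then obtain n :: nat where n: "n \<ge> 1" "a [^] n \<in> q" "a \<in> carrier R" by (rule radicalE)
    have ayK: "y \<otimes> a \<in> K" using y n ideal.I_r_closed[OF iK] by auto
    show "a \<in> ann y"
    proof (rule ccontr)
      assume "a \<notin> ann y"
      then have "y \<otimes> a \<notin> q" using n ayK by (auto simp: ann_def JK)
      moreover have "ann y \<subseteq> ann (y \<otimes> a)"
      proof
        fix r assume r: "r \<in> ann y"
        then have rc: "r \<in> carrier R" "y \<otimes> r \<in> J" by (auto simp: ann_def)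
        have "y \<otimes> a \<otimes> r = a \<otimes> (y \<otimes> r)" using yc n(3) rc(1) by algebra
        then show "r \<in> ann (y \<otimes> a)" using rc n(3) ideal.I_l_closed[OF iJ] by (simp add: ann_def)
      qed
      ultimately have e: "ann (y \<otimes> a) = ann y" using mx ayK by blast
      \<comment> \<open>Since (J : y a) = (J : y), factors \<open>a\<close> can be stripped one at a
        time, from a^n down to 1, which would put y into J.\<close>
      have "a [^] Suc m \<in> ann y \<Longrightarrow> a [^] m \<in> ann y" for m :: nat
      proof -
        assume "a [^] Suc m \<in> ann y"
        moreover have "y \<otimes> a [^] Suc m = y \<otimes> a \<otimes> a [^] m" using yc n(3) by (simp add: m_ac)
        ultimately have "a [^] m \<in> ann (y \<otimes> a)" using n(3) by (simp add: ann_def)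
        then show ?thesis unfolding e .
      qed
      then have "a [^] m \<in> ann y \<Longrightarrow> a [^] (0::nat) \<in> ann y" for m :: nat
        by (induction m) auto
      moreover have "a [^] n \<in> ann y"
        using y n yc ideal.I_l_closed[OF idl[OF q]] ideal.I_r_closed[OF iK] by (auto simp: ann_def JK)
      ultimately have "y \<in> J" using yc by (auto simp: ann_def)
      then show False using y JK by auto
    qed
  qed
  then show ?thesis
    unfolding Ass_quot_module_iff[OF iJ]
    using primary_radical_primeideal[OF prim[OF q]] yc by (auto simp: ann_def)
qed

lemma (in noetherian_cring) primeideal_contains_Ass:
  assumes "ideal J R" "primeideal P R" "J \<subseteq> P"
  shows "\<exists>p\<in>Ass R (quot_module R J). p \<subseteq> P"
proof -
  obtain Q where Q: "minimal_primary_decomposition R J Q"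
    using minimal_primary_decomposition_exists[OF assms(1)] by auto
  have "\<exists>q\<in>Q. q \<subseteq> P"
    using assms Q by (intro primeideal_Inter_finite)
      (auto simp: minimal_primary_decomposition_def primary_ideal_def)
  then show ?thesis
    using radical_primary_component_in_Ass[OF Q] radical_subset_primeideal[OF assms(2)] by blast
qed

text \<open>\<open>mAss\<close> compares associated primes only with each other. As every prime over
  J contains an associated one, its members are minimal among all primes over J.\<close>

lemma (in noetherian_cring) mAss_minimal:
  assumes "ideal J R" "P \<in> mAss R (quot_module R J)" "primeideal P' R" "J \<subseteq> P'" "P' \<subseteq> P"
  shows "P' = P"
proof -
  obtain p where p: "p \<in> Ass R (quot_module R J)" "p \<subseteq> P'"
    using primeideal_contains_Ass[OF assms(1,3,4)] by (rule bexE)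
  then have "p = P" using assms(2,5) by (simp add: mAss_def)
  then show ?thesis using p assms(5) by simp
qed

lemma (in cring) mAss_quot_moduleD:
  assumes "ideal J R" "p \<in> mAss R (quot_module R J)"
  shows "primeideal p R" "J \<subseteq> p"
  using Ass_quot_moduleD[OF assms(1)] assms(2) by (auto simp: mAss_def)

text \<open>The minimal element is chosen among the finitely many radicals of the components of one
  decomposition; every associated prime contains one of them.\<close>

lemma (in noetherian_cring) mAss_nonempty:
  assumes "ideal J R" "J \<noteq> carrier R"
  shows "mAss R (quot_module R J) \<noteq> {}"
proof -
  obtain Q where Q: "minimal_primary_decomposition R J Q"
    using minimal_primary_decomposition_exists[OF assms(1)] by auto
  have fin: "finite (radical R ` Q)" and prim: "\<And>q. q \<in> Q \<Longrightarrow> primary_ideal R q"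
    and J: "J = carrier R \<inter> \<Inter> Q" using Q by (auto simp: minimal_primary_decomposition_def)
  have "Q \<noteq> {}" using J assms(2) by auto
  then have "radical R ` Q \<noteq> {}" by simp
  from finite_has_minimal[OF fin this]
  obtain p where p: "p \<in> radical R ` Q" "\<forall>p'\<in>radical R ` Q. p' \<subseteq> p \<longrightarrow> p = p'" by (rule bexE)
  then have pA: "p \<in> Ass R (quot_module R J)" using radical_primary_component_in_Ass[OF Q] by auto
  have "p' = p" if p': "p' \<in> Ass R (quot_module R J)" "p' \<subseteq> p" for p'
  proof -
    note pd = Ass_quot_moduleD[OF assms(1) p'(1)]
    have "\<exists>q\<in>Q. q \<subseteq> p'"
      using Q pd by (intro primeideal_Inter_finite)
        (auto simp: minimal_primary_decomposition_def primary_ideal_def)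
    then obtain q where q: "q \<in> Q" "radical R q \<subseteq> p'" using radical_subset_primeideal[OF pd(1)] by auto
    then have "radical R q = p" using p(2) p'(2) by blast
    then show ?thesis using q p' by auto
  qed
  then show ?thesis using pA by (auto simp: mAss_def)
qed

text \<open>The contraction to \<open>R\<close> of the extension of \<open>J\<close> to the localization at \<open>P\<close>.\<close>

definition saturation :: "('a, 'b) ring_scheme \<Rightarrow> 'a set \<Rightarrow> 'a set \<Rightarrow> 'a set"
  where "saturation R P J = {r \<in> carrier R. \<exists>s\<in>carrier R - P. s \<otimes>\<^bsub>R\<^esub> r \<in> J}"

lemma (in cring) saturation_ideal:
  assumes P: "primeideal P R" and J: "ideal J R"
  shows "ideal (saturation R P J) R"
proof -
  have sub: "saturation R P J \<subseteq> carrier R" by (auto simp: saturation_def)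
  have one: "\<one> \<in> carrier R - P"
    using ideal.one_imp_carrier[of P R] primeideal.I_notcarr[OF P] primeideal.axioms(1)[OF P] by auto
  have l: "x \<otimes> a \<in> saturation R P J" if a: "a \<in> saturation R P J" and x: "x \<in> carrier R" for a x
  proof -
    obtain s where s: "s \<in> carrier R - P" "s \<otimes> a \<in> J" "a \<in> carrier R"
      using a by (auto simp: saturation_def)
    have "s \<otimes> (x \<otimes> a) = x \<otimes> (s \<otimes> a)" using s x by (simp add: m_ac)
    then have "s \<otimes> (x \<otimes> a) \<in> J" using ideal.I_l_closed[OF J s(2) x] by simp
    then show ?thesis using s x by (auto simp: saturation_def)
  qed
  have add: "a \<oplus> b \<in> saturation R P J" if ab: "a \<in> saturation R P J" "b \<in> saturation R P J" for a b
  proof -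
    obtain s t where s: "s \<in> carrier R - P" "s \<otimes> a \<in> J" "a \<in> carrier R"
      and t: "t \<in> carrier R - P" "t \<otimes> b \<in> J" "b \<in> carrier R"
      using ab by (auto simp: saturation_def)
    have sc: "s \<in> carrier R" "t \<in> carrier R" using s t by auto
    have "s \<otimes> t \<otimes> (a \<oplus> b) = t \<otimes> (s \<otimes> a) \<oplus> s \<otimes> (t \<otimes> b)" using sc s(3) t(3) by algebra
    then have "s \<otimes> t \<otimes> (a \<oplus> b) \<in> J"
      using ideal_add_closed[OF J ideal.I_l_closed[OF J s(2) sc(2)] ideal.I_l_closed[OF J t(2) sc(1)]]
      by simp
    moreover have "s \<otimes> t \<in> carrier R - P" using primeideal.I_prime[OF P sc] s t by auto
    ultimately show ?thesis using s t by (auto simp: saturation_def)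
  qed
  have z: "\<zero> \<in> saturation R P J"
    using one additive_subgroup.zero_closed[OF ideal.axioms(1)[OF J]]
    by (auto simp: saturation_def intro!: bexI[of _ \<one>])
  show ?thesis
  proof (rule idealI[OF ring_axioms])
    show "subgroup (saturation R P J) (add_monoid R)"
    proof (rule add.subgroupI)
      fix a assume a: "a \<in> saturation R P J"
      then have "\<ominus> \<one> \<otimes> a \<in> saturation R P J" by (intro l) auto
      then show "\<ominus> a \<in> saturation R P J" using a sub by (simp add: l_minus subset_iff)
    qed (use sub z add in auto)
    fix a x assume "a \<in> saturation R P J" "x \<in> carrier R"
    then show "x \<otimes> a \<in> saturation R P J" "a \<otimes> x \<in> saturation R P J"
      using l sub m_comm by (auto simp: subset_iff)
  qed
qed

text \<open>Uniqueness of isolated components. Minimality of the radical provides s outside it that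
  lies in all other components, so s q is contained in J; conversely, s r in J with s outside the
  radical forces r into the primary ideal q.\<close>

lemma (in cring) primary_component_eq_saturation:
  assumes Q: "minimal_primary_decomposition R J Q" and q: "q \<in> Q"
    and min: "\<And>P. primeideal P R \<Longrightarrow> J \<subseteq> P \<Longrightarrow> P \<subseteq> radical R q \<Longrightarrow> P = radical R q"
  shows "q = saturation R (radical R q) J"
proof -
  have prim: "primary_ideal R q'" if "q' \<in> Q" for q'
    using Q that by (auto simp: minimal_primary_decomposition_def)
  then have idl: "ideal q' R" if "q' \<in> Q" for q' using that by (auto simp: primary_ideal_def)
  have J: "J = carrier R \<inter> \<Inter> Q" and fin: "finite Q" and inj: "inj_on (radical R) Q"
    using Q by (auto simp: minimal_primary_decomposition_def)
  have P: "primeideal (radical R q) R" by (rule primary_radical_primeideal[OF prim[OF q]])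
  show ?thesis
  proof (intro equalityI subsetI)
    fix r assume r: "r \<in> q"
    have rc: "r \<in> carrier R" using r ideal.Icarr[OF idl[OF q]] by auto
    have "\<not> carrier R \<inter> \<Inter> (Q - {q}) \<subseteq> radical R q"
    proof
      assume "carrier R \<inter> \<Inter> (Q - {q}) \<subseteq> radical R q"
      then have "\<exists>q'\<in>Q - {q}. q' \<subseteq> radical R q"
        using P fin idl by (intro primeideal_Inter_finite) auto
      then obtain q' where q': "q' \<in> Q" "q' \<noteq> q" "radical R q' \<subseteq> radical R q"
        using radical_subset_primeideal[OF P] by auto
      have "J \<subseteq> radical R q'" using subset_radical[OF idl[OF q'(1)]] J q' by auto
      then have "radical R q' = radical R q"
        using min[OF primary_radical_primeideal[OF prim[OF q'(1)]]] q' by auto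
      then show False using inj q' q by (auto simp: inj_on_def)
    qed
    then obtain s where s: "s \<in> carrier R" "\<And>q'. q' \<in> Q \<Longrightarrow> q' \<noteq> q \<Longrightarrow> s \<in> q'" "s \<notin> radical R q" by auto
    have "s \<otimes> r \<in> q'" if q': "q' \<in> Q" for q'
      using ideal.I_l_closed[OF idl[OF q]] ideal.I_r_closed[OF idl[OF q']] s r rc q'
      by (cases "q' = q") auto
    then have "s \<otimes> r \<in> J" unfolding J using s rc by auto
    then show "r \<in> saturation R (radical R q) J" using s rc by (auto simp: saturation_def)
  next
    fix r assume "r \<in> saturation R (radical R q) J"
    then obtain s where s: "s \<in> carrier R" "s \<notin> radical R q" "s \<otimes> r \<in> J" "r \<in> carrier R"
      by (auto simp: saturation_def)
    have "r \<otimes> s \<in> q" using s q J m_comm by auto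
    then show "r \<in> q" using prim[OF q] s by (auto simp: primary_ideal_def)
  qed
qed

section \<open>Powers of ideals and a formula for symbolic powers\<close>

lemma (in cring) ideal_power_0 [simp]: "ideal_power R I 0 = carrier R"
  using comm_monoid.axioms(1)[OF ideals_set_is_comm_monoid]
  by (simp add: ideal_power_def monoid.nat_pow_0) (simp add: ideals_set_def)

lemma (in cring) ideal_power_Suc: "ideal_power R I (Suc n) = ideal_prod R (ideal_power R I n) I"
  using comm_monoid.axioms(1)[OF ideals_set_is_comm_monoid]
  by (simp add: ideal_power_def monoid.nat_pow_Suc) (simp add: ideals_set_def)

lemma (in cring) ideal_power_ideal:
  assumes "ideal I R" shows "ideal (ideal_power R I n) R"
  by (induction n) (auto simp: ideal_power_Suc oneideal assms ideal_prod_is_ideal)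

lemma (in cring) ideal_prod_subset:
  assumes "ideal K R" "\<And>i j. i \<in> I \<Longrightarrow> j \<in> J \<Longrightarrow> i \<otimes> j \<in> K"
  shows "ideal_prod R I J \<subseteq> K"
proof
  fix s assume "s \<in> ideal_prod R I J"
  then show "s \<in> K" by (induction rule: ideal_prod.induct) (auto simp: assms(2) ideal_add_closed[OF assms(1)])
qed

lemma (in cring) ideal_power_mono:
  assumes "ideal I R" "ideal J R" "I \<subseteq> J"
  shows "ideal_power R I n \<subseteq> ideal_power R J n"
proof (induction n)
  case (Suc n)
  show ?case unfolding ideal_power_Suc
    by (rule ideal_prod_subset)
      (use Suc assms in \<open>auto intro!: ideal_prod.prod ideal_prod_is_ideal ideal_power_ideal\<close>)
qed simp

lemma (in cring) ideal_power_1 [simp]: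
  assumes "ideal I R" shows "ideal_power R I 1 = I"
  using ideal_prod_commute[OF oneideal assms] ideal_prod_one[OF assms] by (simp add: ideal_power_Suc)

lemma (in cring) ideal_power_subset:
  assumes "ideal I R" "n \<ge> 1"
  shows "ideal_power R I n \<subseteq> I"
proof -
  obtain m where "n = Suc m" using assms(2) by (cases n) auto
  then show ?thesis
    using ideal_prod_inter[OF ideal_power_ideal[OF assms(1)] assms(1)] by (auto simp: ideal_power_Suc)
qed

lemma (in cring) power_mem_ideal_power:
  assumes "a \<in> I" "a \<in> carrier R"
  shows "a [^] (n::nat) \<in> ideal_power R I n"
  by (induction n) (auto simp: ideal_power_Suc assms intro: ideal_prod.prod)

lemma (in cring) primeideal_ideal_powerD:
  assumes "primeideal P R" "ideal I R" "ideal_power R I n \<subseteq> P"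
  shows "I \<subseteq> P"
  using primeideal_powerD[OF assms(1)] power_mem_ideal_power[of _ I n] assms(3) ideal.Icarr[OF assms(2)]
  by blast

text \<open>A prime over I^k contains I, so a minimal prime of I is also minimal over I^k. Hence it
  is the radical of a component of I^k, and that component is the saturation.\<close>

lemma (in noetherian_cring) symbolic_power_eq:
  assumes I: "ideal I R" and k: "k \<ge> 1"
  shows "symbolic_power R I k =
    carrier R \<inter> (\<Inter>P\<in>mAss R (quot_module R I). saturation R P (ideal_power R I k))"
proof -
  let ?J = "ideal_power R I k"
  have J: "ideal ?J R" by (rule ideal_power_ideal[OF I])
  have min: "P' = P" if "P \<in> mAss R (quot_module R I)" "primeideal P' R" "?J \<subseteq> P'" "P' \<subseteq> P" for P P'
    using mAss_minimal[OF I that(1,2) primeideal_ideal_powerD[OF that(2) I that(3)] that(4)] .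
  have 1: "q = saturation R (radical R q) ?J"
    if q: "primary_component R ?J q" "radical R q \<in> mAss R (quot_module R I)" for q
  proof -
    obtain Q where "minimal_primary_decomposition R ?J Q" "q \<in> Q"
      using q(1) by (auto simp: primary_component_def)
    then show ?thesis by (rule primary_component_eq_saturation) (rule min[OF q(2)])
  qed
  have 2: "\<exists>q. primary_component R ?J q \<and> radical R q = P"
    if P: "P \<in> mAss R (quot_module R I)" for P
  proof -
    obtain Q where Q: "minimal_primary_decomposition R ?J Q"
      using minimal_primary_decomposition_exists[OF J] by auto
    note pP = mAss_quot_moduleD[OF I P]
    have "?J \<subseteq> P" using ideal_power_subset[OF I k] pP by auto
    then have "\<exists>q\<in>Q. q \<subseteq> P"
      using pP Q by (intro primeideal_Inter_finite)
        (auto simp: minimal_primary_decomposition_def primary_ideal_def)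
    then obtain q where q: "q \<in> Q" "radical R q \<subseteq> P" using radical_subset_primeideal[OF pP(1)] by auto
    have prim: "primary_ideal R q" using Q q by (auto simp: minimal_primary_decomposition_def)
    have "?J \<subseteq> q" using Q q by (auto simp: minimal_primary_decomposition_def)
    then have "?J \<subseteq> radical R q" using subset_radical[of q] prim by (auto simp: primary_ideal_def)
    then have "radical R q = P" using min[OF P primary_radical_primeideal[OF prim]] q by auto
    then show ?thesis using Q q by (auto simp: primary_component_def)
  qed
  have "{q. primary_component R ?J q \<and> radical R q \<in> mAss R (quot_module R I)} =
      (\<lambda>P. saturation R P ?J) ` mAss R (quot_module R I)"
    using 1 2 by (force simp: image_iff)
  then show ?thesis by (simp add: symbolic_power_def)
qed

text \<open>If y were in P = (I : y), then y^2 and hence y would be in I, making P the whole ring.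
  With y outside P and y P inside I, the ideals I and P agree locally at P.\<close>

lemma (in cring) radical_Ass_colon:
  assumes I: "ideal I R" and rad: "radical R I \<subseteq> I" and P: "P \<in> Ass R (quot_module R I)"
  obtains y where "y \<in> carrier R - P" "P = {r \<in> carrier R. y \<otimes> r \<in> I}"
proof -
  obtain y where y: "y \<in> carrier R" "P = {r \<in> carrier R. y \<otimes> r \<in> I}"
    using P unfolding Ass_quot_module_iff[OF I] by auto
  have "y \<notin> P"
  proof
    assume "y \<in> P"
    then have "y [^] (2::nat) \<in> I" using y by (simp add: numeral_2_eq_2)
    then have "y \<in> I" using rad y radicalI[of y R 2 I] by auto
    then have "\<one> \<in> P" using y by simp
    moreover have pr: "primeideal P R" by (rule Ass_quot_moduleD(1)[OF I P])
    ultimately show False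
      using ideal.one_imp_carrier[OF primeideal.axioms(1)[OF pr]] primeideal.I_notcarr[OF pr] by auto
  qed
  then show ?thesis using that[of y] y(1) y(2) by blast
qed

lemma (in cring) radical_Ass_minimal:
  assumes I: "ideal I R" and rad: "radical R I \<subseteq> I" and P: "P \<in> Ass R (quot_module R I)"
    and P': "primeideal P' R" "I \<subseteq> P'" "P' \<subseteq> P"
  shows "P' = P"
proof -
  obtain y where y: "y \<in> carrier R - P" "P = {r \<in> carrier R. y \<otimes> r \<in> I}"
    by (rule radical_Ass_colon[OF I rad P])
  have "r \<in> P'" if "r \<in> P" for r
  proof -
    have "r \<in> carrier R" "y \<otimes> r \<in> I" using that y(2) by auto
    then show ?thesis using primeideal.I_prime[OF P'(1), of y r] P' y(1) by auto
  qed
  then show ?thesis using P' by auto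
qed

lemma (in cring) radical_mAss_eq_Ass:
  assumes I: "ideal I R" and rad: "radical R I \<subseteq> I"
  shows "mAss R (quot_module R I) = Ass R (quot_module R I)"
  unfolding mAss_def using radical_Ass_minimal[OF assms] Ass_quot_moduleD[OF I] by blast

text \<open>For radical I all associated primes of R/I are minimal. If the powers agree, an
  associated prime of I^k is shown to lie in, hence to equal, a minimal prime of I. Conversely,
  under the inclusion every component of I^k belongs to a minimal prime of I, so the symbolic power
  omits none of them.\<close>

theorem (in noetherian_cring) symbolic_power_eq_ideal_power_iff:
  assumes I: "ideal I R" and rad: "radical R I \<subseteq> I" and k: "k \<ge> 1"
  shows "symbolic_power R I k = ideal_power R I k \<longleftrightarrow>
    Ass R (quot_module R (ideal_power R I k)) \<subseteq> Ass R (quot_module R I)"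
proof
  let ?J = "ideal_power R I k"
  have J: "ideal ?J R" by (rule ideal_power_ideal[OF I])
  show "Ass R (quot_module R ?J) \<subseteq> Ass R (quot_module R I)" if eq: "symbolic_power R I k = ?J"
  proof
    fix p assume p: "p \<in> Ass R (quot_module R ?J)"
    then obtain y where y: "y \<in> carrier R" "p = {r \<in> carrier R. y \<otimes> r \<in> ?J}"
      unfolding Ass_quot_module_iff[OF J] by auto
    note pp = Ass_quot_moduleD[OF J p]
    have "y \<notin> ?J"
    proof
      assume "y \<in> ?J"
      then have "p = carrier R" using y ideal.I_r_closed[OF J] by auto
      then show False using primeideal.I_notcarr[OF pp(1)] by simp
    qed
    then obtain P where P: "P \<in> mAss R (quot_module R I)" "y \<notin> saturation R P ?J"
      using y(1) eq unfolding symbolic_power_eq[OF I k] by blast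
    \<comment> \<open>An element r of p outside P would witness, by r y in I^k, that y lies in the
      saturation at P.\<close>
    have "p \<subseteq> P"
    proof
      fix r assume "r \<in> p"
      then have r: "r \<in> carrier R" "r \<otimes> y \<in> ?J" using y(1) m_comm unfolding y(2) by auto
      then show "r \<in> P" using P(2) y(1) by (auto simp: saturation_def)
    qed
    then have "p = P"
      using mAss_minimal[OF I P(1) pp(1) primeideal_ideal_powerD[OF pp(1) I pp(2)]] by simp
    then show "p \<in> Ass R (quot_module R I)" using P(1) by (simp add: mAss_def)
  qed
  show "symbolic_power R I k = ?J" if sub: "Ass R (quot_module R ?J) \<subseteq> Ass R (quot_module R I)"
  proof (rule equalityI)
    obtain Q where Q: "minimal_primary_decomposition R ?J Q"
      using minimal_primary_decomposition_exists[OF J] by auto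
    have "radical R q \<in> mAss R (quot_module R I)" if "q \<in> Q" for q
      using radical_primary_component_in_Ass[OF Q that] sub radical_mAss_eq_Ass[OF I rad] by auto
    then have "symbolic_power R I k \<subseteq> carrier R \<inter> \<Inter> Q"
      using Q by (auto simp: symbolic_power_def primary_component_def)
    also have "\<dots> = ?J" using Q by (simp add: minimal_primary_decomposition_def)
    finally show "symbolic_power R I k \<subseteq> ?J" .
    show "?J \<subseteq> symbolic_power R I k"
      using ideal.Icarr[OF J]
      by (auto simp: symbolic_power_def primary_component_def minimal_primary_decomposition_def)
  qed
qed

subsection \<open>Regular sequences in the Jacobson radical\<close>

text \<open>J may be the whole ring, where the condition is vacuous; this covers zeroth powers among
  the generators.\<close>

definition nonzerodivisor_mod :: "('a, 'b) ring_scheme \<Rightarrow> 'a set \<Rightarrow> 'a \<Rightarrow> bool"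
  where "nonzerodivisor_mod R J y \<longleftrightarrow> (\<forall>r\<in>carrier R. y \<otimes>\<^bsub>R\<^esub> r \<in> J \<longrightarrow> r \<in> J)"

lemma nonzerodivisor_modD:
  "nonzerodivisor_mod R J y \<Longrightarrow> r \<in> carrier R \<Longrightarrow> y \<otimes>\<^bsub>R\<^esub> r \<in> J \<Longrightarrow> r \<in> J"
  by (simp add: nonzerodivisor_mod_def)

text \<open>Put K = (J : y). Each z in K has the form j + t x, and cancelling x shows that t is
  again in K. So K = J + x K, and Nakayama gives K = J.\<close>

lemma (in noetherian_cring) nonzerodivisor_mod_of_insert:
  assumes J: "ideal J R" and xy: "x \<in> carrier R" "y \<in> carrier R" "x \<in> jacobson_radical R"
    and x: "nonzerodivisor_mod R J x" and y: "nonzerodivisor_mod R (Idl (insert x J)) y"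
  shows "nonzerodivisor_mod R J y"
proof -
  define K where "K = {r \<in> carrier R. y \<otimes> r \<in> J}"
  have K: "ideal K R" unfolding K_def by (rule colon_ideal[OF J xy(2)])
  have JK: "J \<subseteq> K" using ideal.I_l_closed[OF J] ideal.Icarr[OF J] xy by (auto simp: K_def)
  have "K \<subseteq> J"
  proof (rule nakayama[OF J K, of "{x}"])
    show "{x} \<subseteq> jacobson_radical R" using xy by simp
    show "J \<subseteq> K" by (rule JK)
    fix L assume L: "ideal L R" "J \<subseteq> L" "\<And>p k. p \<in> {x} \<Longrightarrow> k \<in> K \<Longrightarrow> p \<otimes> k \<in> L"
    show "K \<subseteq> L"
    proof
      fix z assume "z \<in> K"
      then have z: "z \<in> carrier R" "y \<otimes> z \<in> J" by (auto simp: K_def)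
      then have "y \<otimes> z \<in> Idl (insert x J)" using genideal_insert_ideal(2)[OF J xy(1)] by auto
      then have "z \<in> Idl (insert x J)" using nonzerodivisor_modD[OF y z(1)] by simp
      then obtain j t where jt: "j \<in> J" "t \<in> carrier R" "z = j \<oplus> t \<otimes> x"
        unfolding mem_genideal_insert[OF J xy(1)] by blast
      have jc: "j \<in> carrier R" by (rule ideal.Icarr[OF J jt(1)])
      have yj: "y \<otimes> j \<in> J" by (rule ideal.I_l_closed[OF J jt(1) xy(2)])
      have "y \<otimes> z = y \<otimes> j \<oplus> x \<otimes> (y \<otimes> t)" unfolding jt(3) using jt(2) jc xy(1,2) by algebra
      then have "y \<otimes> j \<oplus> x \<otimes> (y \<otimes> t) \<in> J" using z by simp
      then have "x \<otimes> (y \<otimes> t) \<in> J"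
        by (rule ideal_add_cancel[OF J yj, rotated]) (use xy jt in simp)
      then have "y \<otimes> t \<in> J" by (rule nonzerodivisor_modD[OF x, rotated]) (use xy jt in simp)
      then have "t \<in> K" using jt by (simp add: K_def)
      then have "x \<otimes> t \<in> L" using L(3) by simp
      then have "t \<otimes> x \<in> L" using m_comm jt xy by simp
      then show "z \<in> L" unfolding jt(3) using ideal_add_closed[OF L(1)] jt(1) L(2) by blast
    qed
  qed
  then show ?thesis by (auto simp: nonzerodivisor_mod_def K_def)
qed

text \<open>From x r = j + s y it follows that y s, and so s, is in J + x R. Substituting s = j' + t
  x and cancelling x yields r - t y in J.\<close>

lemma (in cring) nonzerodivisor_mod_insert_swap:
  assumes J: "ideal J R" and xy: "x \<in> carrier R" "y \<in> carrier R"
    and x: "nonzerodivisor_mod R J x" and y: "nonzerodivisor_mod R (Idl (insert x J)) y"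
  shows "nonzerodivisor_mod R (Idl (insert y J)) x"
  unfolding nonzerodivisor_mod_def
proof (intro ballI impI)
  fix r assume r: "r \<in> carrier R" "x \<otimes> r \<in> Idl (insert y J)"
  obtain j s where js: "j \<in> J" "s \<in> carrier R" "x \<otimes> r = j \<oplus> s \<otimes> y"
    using r(2) unfolding mem_genideal_insert[OF J xy(2)] by blast
  have jc: "j \<in> carrier R" by (rule ideal.Icarr[OF J js(1)])
  have "y \<otimes> s = \<ominus> j \<oplus> (j \<oplus> s \<otimes> y)" using jc js(2) xy(2) by algebra
  also have "\<dots> = \<ominus> j \<oplus> r \<otimes> x" unfolding js(3)[symmetric] using r xy m_comm by simp
  finally have "y \<otimes> s = \<ominus> j \<oplus> r \<otimes> x" .
  moreover have "\<ominus> j \<in> J" using additive_subgroup.a_inv_closed[OF ideal.axioms(1)[OF J] js(1)] .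
  ultimately have "y \<otimes> s \<in> Idl (insert x J)" unfolding mem_genideal_insert[OF J xy(1)] using r by blast
  then have "s \<in> Idl (insert x J)" by (rule nonzerodivisor_modD[OF y js(2)])
  then obtain j' t where jt: "j' \<in> J" "t \<in> carrier R" "s = j' \<oplus> t \<otimes> x"
    unfolding mem_genideal_insert[OF J xy(1)] by blast
  have jc': "j' \<in> carrier R" by (rule ideal.Icarr[OF J jt(1)])
  have "x \<otimes> (r \<ominus> t \<otimes> y) = x \<otimes> r \<ominus> x \<otimes> (t \<otimes> y)" using xy r(1) jt(2) by algebra
  also have "\<dots> = j \<oplus> j' \<otimes> y" unfolding js(3) jt(3) using xy jc jc' jt(2) by algebra
  finally have "x \<otimes> (r \<ominus> t \<otimes> y) \<in> J"
    using ideal_add_closed[OF J js(1) ideal.I_r_closed[OF J jt(1) xy(2)]] by simp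
  then have "r \<ominus> t \<otimes> y \<in> J" by (rule nonzerodivisor_modD[OF x, rotated]) (use r xy jt in simp)
  moreover have "r = (r \<ominus> t \<otimes> y) \<oplus> t \<otimes> y" using r(1) jt(2) xy by algebra
  ultimately show "r \<in> Idl (insert y J)" unfolding mem_genideal_insert[OF J xy(2)] using jt(2) by blast
qed

lemma (in cring) nonzerodivisor_mod_power:
  assumes "x \<in> carrier R" "nonzerodivisor_mod R J x" "r \<in> carrier R" "x [^] (n::nat) \<otimes> r \<in> J"
  shows "r \<in> J"
  using assms(3,4)
proof (induction n arbitrary: r)
  case (Suc n)
  have "x [^] n \<otimes> (x \<otimes> r) \<in> J" using Suc.prems assms(1) by (simp add: m_assoc)
  then have "x \<otimes> r \<in> J" using Suc.IH assms(1) Suc.prems by simp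
  then show ?case using nonzerodivisor_modD[OF assms(2)] Suc.prems by simp
qed simp

text \<open>The previous exponent gives r = j' + t x^n. Cancelling x^n from the relation for x^(n+1)
  leaves y t in J + x R, so t supplies the missing factor x.\<close>

lemma (in cring) nonzerodivisor_mod_insert_power:
  assumes J: "ideal J R" and xy: "x \<in> carrier R" "y \<in> carrier R"
    and x: "nonzerodivisor_mod R J x" and y: "nonzerodivisor_mod R (Idl (insert x J)) y"
  shows "nonzerodivisor_mod R (Idl (insert (x [^] (n::nat)) J)) y"
proof (induction n)
  case 0
  have "Idl (insert \<one> J) = carrier R"
    using ideal.one_imp_carrier[OF genideal_insert_ideal(1)[OF J]] genideal_insert_ideal(3)[OF J] by simp
  then show ?case by (simp add: nonzerodivisor_mod_def)
next
  case (Suc n)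
  have xn: "x [^] n \<in> carrier R" "x [^] Suc n \<in> carrier R" using xy by simp_all
  note [simp del] = nat_pow_Suc
  show ?case
    unfolding nonzerodivisor_mod_def
  proof (intro ballI impI)
    fix r assume r: "r \<in> carrier R" "y \<otimes> r \<in> Idl (insert (x [^] Suc n) J)"
    obtain j s where js: "j \<in> J" "s \<in> carrier R" "y \<otimes> r = j \<oplus> s \<otimes> x [^] Suc n"
      using r(2) unfolding mem_genideal_insert[OF J xn(2)] by blast
    have "y \<otimes> r = j \<oplus> (s \<otimes> x) \<otimes> x [^] n" unfolding js(3) using js(2) xn xy by (simp add: nat_pow_Suc m_ac)
    then have "y \<otimes> r \<in> Idl (insert (x [^] n) J)"
      unfolding mem_genideal_insert[OF J xn(1)] using js xy by blast
    then have "r \<in> Idl (insert (x [^] n) J)" by (rule nonzerodivisor_modD[OF Suc r(1)])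
    then obtain j' t where jt: "j' \<in> J" "t \<in> carrier R" "r = j' \<oplus> t \<otimes> x [^] n"
      unfolding mem_genideal_insert[OF J xn(1)] by blast
    have jc: "j \<in> carrier R" "j' \<in> carrier R" using ideal.Icarr[OF J] js(1) jt(1) by auto
    have "x [^] n \<otimes> (y \<otimes> t \<ominus> s \<otimes> x) = y \<otimes> r \<ominus> y \<otimes> j' \<ominus> s \<otimes> x [^] Suc n"
      unfolding jt(3) nat_pow_Suc using xn(1) xy jt(2) js(2) jc by algebra
    also have "\<dots> = j \<ominus> y \<otimes> j'" unfolding js(3) using xn(2) xy jc js(2) by algebra
    finally have "x [^] n \<otimes> (y \<otimes> t \<ominus> s \<otimes> x) = j \<oplus> (\<ominus> y) \<otimes> j'" using jc xy by algebra
    then have "x [^] n \<otimes> (y \<otimes> t \<ominus> s \<otimes> x) \<in> J"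
      using ideal_add_closed[OF J js(1) ideal.I_l_closed[OF J jt(1), of "\<ominus> y"]] xy by simp
    then have *: "y \<otimes> t \<ominus> s \<otimes> x \<in> J"
      by (rule nonzerodivisor_mod_power[OF xy(1) x, rotated]) (use xy js jt in simp)
    have "y \<otimes> t = (y \<otimes> t \<ominus> s \<otimes> x) \<oplus> s \<otimes> x" using xy js(2) jt(2) by algebra
    then have "y \<otimes> t \<in> Idl (insert x J)" unfolding mem_genideal_insert[OF J xy(1)] using * js(2) by blast
    then have "t \<in> Idl (insert x J)" by (rule nonzerodivisor_modD[OF y jt(2)])
    then obtain j'' u where ju: "j'' \<in> J" "u \<in> carrier R" "t = j'' \<oplus> u \<otimes> x"
      unfolding mem_genideal_insert[OF J xy(1)] by blast
    have jc'': "j'' \<in> carrier R" using ideal.Icarr[OF J] ju(1) by auto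
    have "r = (j' \<oplus> j'' \<otimes> x [^] n) \<oplus> u \<otimes> x [^] Suc n"
      unfolding jt(3) ju(3) nat_pow_Suc using xn(1) xy jc jc'' ju(2) by algebra
    moreover have "j' \<oplus> j'' \<otimes> x [^] n \<in> J"
      by (rule ideal_add_closed[OF J jt(1) ideal.I_r_closed[OF J ju(1) xn(1)]])
    ultimately show "r \<in> Idl (insert (x [^] Suc n) J)"
      unfolding mem_genideal_insert[OF J xn(2)] using ju(2) by blast
  qed
qed

locale prime_regular_sequence = noetherian_cring +
  fixes x :: "nat \<Rightarrow> 'a" and d :: nat
  assumes regular: "regular_sequence R x d"
    and jacobson: "x ` {1..d} \<subseteq> jacobson_radical R"
    and prime: "primeideal (Idl (x ` {1..d})) R"
begin

lemma x_closed: "i \<in> {1..d} \<Longrightarrow> x i \<in> carrier R"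
  using regular unfolding regular_sequence_def image_subset_iff by blast

lemma x_image_closed: "A \<subseteq> {1..d} \<Longrightarrow> x ` A \<subseteq> carrier R"
  using x_closed by auto

text \<open>Permutability of the sequence, by induction on its length. The last element is treated
  first, against all subsets of its predecessors; an earlier one is then handled by a swap if the
  last index belongs to A.\<close>

lemma nonzerodivisor_mod_any_order_upto:
  assumes "m \<le> d" "A \<subseteq> {1..m}" "i \<in> {1..m} - A"
  shows "nonzerodivisor_mod R (Idl (x ` A)) (x i)"
  using assms
proof (induction m arbitrary: A i)
  case (Suc m)
  note IH = Suc.IH[OF Suc_leD[OF Suc.prems(1)]] and m = Suc.prems(1)
  have sub: "{1..m} \<subseteq> {1..d}" "{1..Suc m} \<subseteq> {1..d}" using m by auto
  have ideals: "ideal (Idl (x ` A)) R" if "A \<subseteq> {1..d}" for A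
    using that by (intro genideal_ideal x_image_closed)
  have ins: "Idl (insert (x j) (Idl (x ` A))) = Idl (x ` insert j A)"
    if "A \<subseteq> {1..d}" "j \<in> {1..d}" for A j
    using genideal_insert_genideal[OF x_image_closed x_closed, of A j] that by simp
  \<comment> \<open>Regularity is given modulo all predecessors. They are removed one at a time by
    Nakayama, the induction running over the number of removed indices.\<close>
  have top: "nonzerodivisor_mod R (Idl (x ` A)) (x (Suc m))" if "A \<subseteq> {1..m}" for A
    using that
  proof (induction "card ({1..m} - A)" arbitrary: A)
    case 0
    then have A: "A = {1..<Suc m}" by auto
    show ?case using regular Suc.prems(1) unfolding A nonzerodivisor_mod_def regular_sequence_def by auto
  next
    case (Suc c)
    then obtain j where j: "j \<in> {1..m} - A" by (metis card.empty equals0I nat.simps(3))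
    have "c = card ({1..m} - insert j A)" using Suc.hyps(2) j
      by (metis Diff_insert card_Diff_singleton diff_Suc_1)
    then have "nonzerodivisor_mod R (Idl (x ` insert j A)) (x (Suc m))"
      using Suc.prems j by (intro Suc.hyps(1)) auto
    then have "nonzerodivisor_mod R (Idl (insert (x j) (Idl (x ` A)))) (x (Suc m))"
      using ins[of A j] Suc.prems j sub(1) by (metis DiffD1 subset_iff)
    moreover have "nonzerodivisor_mod R (Idl (x ` A)) (x j)"
      using Suc.prems j IH by blast
    moreover have "ideal (Idl (x ` A)) R" using ideals[of A] Suc.prems sub(1) by blast
    moreover have "j \<in> {1..d}" "Suc m \<in> {1..d}" using j m by auto
    then have "x j \<in> carrier R" "x (Suc m) \<in> carrier R" "x j \<in> jacobson_radical R"
      using x_closed jacobson by blast+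
    ultimately show ?case using nonzerodivisor_mod_of_insert by blast
  qed
  show ?case
  proof (cases "i = Suc m")
    case True
    then have "A \<subseteq> {1..m}" using Suc.prems by (auto simp: atLeastAtMostSuc_conv)
    then show ?thesis using top True by simp
  next
    case False
    then have i: "i \<in> {1..m}" "i \<notin> A" using Suc.prems by auto
    let ?B = "A - {Suc m}"
    have B: "?B \<subseteq> {1..m}" using Suc.prems by (auto simp: atLeastAtMostSuc_conv)
    have nB: "nonzerodivisor_mod R (Idl (x ` ?B)) (x i)" using IH[OF B] i by auto
    show ?thesis
    proof (cases "Suc m \<in> A")
      case True
      then have A: "insert (Suc m) ?B = A" by auto
      have "nonzerodivisor_mod R (Idl (insert (x (Suc m)) (Idl (x ` ?B)))) (x i)"
      proof (rule nonzerodivisor_mod_insert_swap[OF _ _ _ nB])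
        show "ideal (Idl (x ` ?B)) R" using ideals B sub(1) by blast
        show "x i \<in> carrier R" "x (Suc m) \<in> carrier R" using x_closed i Suc.prems by auto
        have "insert i ?B \<subseteq> {1..m}" using B i by auto
        then show "nonzerodivisor_mod R (Idl (insert (x i) (Idl (x ` ?B)))) (x (Suc m))"
          using top ins[of ?B i] B i(1) sub(1) by (metis subset_iff)
      qed
      moreover have "?B \<subseteq> {1..d}" "Suc m \<in> {1..d}" using B m sub(1) by auto
      ultimately show ?thesis using ins[of ?B "Suc m", unfolded A] by simp
    next
      case False then show ?thesis using nB by simp
    qed
  qed
qed simp

text \<open>Plain generators (\<open>B\<close>) stand beside powers (\<open>A\<close>) so that the
  induction can trade one plain generator for its power.\<close>

lemma nonzerodivisor_mod_powers:
  fixes n :: "nat \<Rightarrow> nat"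
  assumes "finite A" "A \<inter> B = {}" "A \<union> B \<subseteq> {1..d}" "i \<in> {1..d} - (A \<union> B)"
  shows "nonzerodivisor_mod R (Idl ((\<lambda>j. x j [^] n j) ` A \<union> x ` B)) (x i)"
  using assms
proof (induction A arbitrary: B i)
  case empty
  then show ?case using nonzerodivisor_mod_any_order_upto[of d B i] by auto
next
  case (insert j A)
  let ?S = "(\<lambda>j. x j [^] n j) ` A \<union> x ` B"
  have j: "j \<in> {1..d}" "j \<notin> A \<union> B" using insert by auto
  have S: "?S \<subseteq> carrier R" using insert.prems x_closed by (auto intro!: nat_pow_closed)
  have "nonzerodivisor_mod R (Idl (insert (x j [^] n j) (Idl ?S))) (x i)"
  proof (rule nonzerodivisor_mod_insert_power[OF genideal_ideal[OF S]])
    show "x j \<in> carrier R" "x i \<in> carrier R" using x_closed insert by auto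
    show "nonzerodivisor_mod R (Idl ?S) (x j)" using insert j by auto
    have "Idl (insert (x j) (Idl ?S)) = Idl ((\<lambda>j. x j [^] n j) ` A \<union> x ` insert j B)"
      using genideal_insert_genideal[OF S, of "x j"] x_closed j by simp
    then show "nonzerodivisor_mod R (Idl (insert (x j) (Idl ?S))) (x i)"
      using insert.IH[of "insert j B" i] insert.prems insert.hyps j by auto
  qed
  then show ?case using genideal_insert_genideal[OF S, of "x j [^] n j"] x_closed j by simp
qed

text \<open>One factor is removed at a time: x_j is a nonzerodivisor modulo the other generators, so
  x_j^e can be cancelled against x_j^(e+1), which leaves the plain generator x_j and moves j from
  \<open>A\<close> to \<open>B\<close>.\<close>

lemma coefficient_mem_of_finprod:
  assumes "finite A" "A \<inter> B = {}" "A \<union> B = {1..d}" "a \<in> carrier R"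
    and "a \<otimes> (\<Otimes>j\<in>A. x j [^] (e j :: nat)) \<in> Idl ((\<lambda>j. x j [^] Suc (e j)) ` A \<union> x ` B)"
  shows "a \<in> Idl (x ` {1..d})"
  using assms
proof (induction A arbitrary: B)
  case empty
  have "a \<otimes> \<one> \<in> Idl ({} \<union> x ` B)" using empty.prems(4) by simp
  then show ?case using empty.prems(2,3) by simp
next
  case (insert j A)
  let ?S = "(\<lambda>j. x j [^] Suc (e j)) ` A \<union> x ` B"
  have jAB: "insert j A \<union> B = {1..d}" "insert j A \<inter> B = {}" by (rule insert.prems(2), rule insert.prems(1))
  have jd: "j \<in> {1..d}" and A: "A \<subseteq> {1..d}" and B: "B \<subseteq> {1..d}" unfolding jAB(1)[symmetric] by blast+
  have j: "x j \<in> carrier R" "j \<notin> A" using x_closed[OF jd] insert.hyps by auto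
  have pc: "x i [^] (n::nat) \<in> carrier R" if "i \<in> {1..d}" for i n using x_closed[OF that] by simp
  have cl: "(\<lambda>j. x j [^] e j) \<in> A \<rightarrow> carrier R" using pc A by blast
  define b where "b = a \<otimes> (\<Otimes>j\<in>A. x j [^] e j)"
  have b: "b \<in> carrier R" unfolding b_def using insert.prems(3) finprod_closed[OF cl] by simp
  have S: "?S \<subseteq> carrier R" using pc A B x_closed by blast
  note iS = genideal_ideal[OF S]
  have xe: "x j [^] e j \<in> carrier R" "x j [^] Suc (e j) \<in> carrier R"
    using pc[OF jd] by blast+
  have "a \<otimes> (\<Otimes>j\<in>insert j A. x j [^] e j) = x j [^] e j \<otimes> b"
    unfolding b_def using insert.hyps cl xe(1) insert.prems(3) finprod_closed[OF cl]
    by (simp add: finprod_insert m_ac)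
  then have "x j [^] e j \<otimes> b \<in> Idl (insert (x j [^] Suc (e j)) (Idl ?S))"
    using insert.prems(4) unfolding genideal_insert_genideal[OF S xe(2)] by simp
  then obtain s t where st: "s \<in> Idl ?S" "t \<in> carrier R" "x j [^] e j \<otimes> b = s \<oplus> t \<otimes> x j [^] Suc (e j)"
    unfolding mem_genideal_insert[OF iS xe(2)] by blast
  have sc: "s \<in> carrier R" by (rule ideal.Icarr[OF iS st(1)])
  have "x j [^] e j \<otimes> (b \<ominus> t \<otimes> x j) = x j [^] e j \<otimes> b \<ominus> t \<otimes> (x j [^] e j \<otimes> x j)"
    using xe(1) b st(2) j(1) by algebra
  also have "\<dots> = s" unfolding st(3) nat_pow_Suc using sc st(2) xe(1) j(1) by algebra
  finally have "x j [^] e j \<otimes> (b \<ominus> t \<otimes> x j) \<in> Idl ?S" using st(1) by simp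
  moreover have "nonzerodivisor_mod R (Idl ?S) (x j)"
    using insert.hyps jAB by (intro nonzerodivisor_mod_powers) auto
  ultimately have "b \<ominus> t \<otimes> x j \<in> Idl ?S"
    using nonzerodivisor_mod_power[OF j(1), of "Idl ?S" "b \<ominus> t \<otimes> x j"] b st(2) j(1) by simp
  moreover have "b = (b \<ominus> t \<otimes> x j) \<oplus> t \<otimes> x j" using b st(2) j(1) by algebra
  ultimately have "b \<in> Idl (insert (x j) (Idl ?S))"
    unfolding mem_genideal_insert[OF iS j(1)] using st(2) by blast
  then have "b \<in> Idl ((\<lambda>j. x j [^] Suc (e j)) ` A \<union> x ` insert j B)"
    using genideal_insert_genideal[OF S j(1)] by simp
  then show ?case unfolding b_def using insert.prems insert.hyps
    by (intro insert.IH[of "insert j B"]) auto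
qed

subsection \<open>Monomial ideals of a regular sequence\<close>

text \<open>\<open>monomial\<close> ignores values outside {1..d}. Fixing them to 0 makes exponent
  vectors comparable as functions, with pointwise sum, difference and order.\<close>

definition exponents :: "(nat \<Rightarrow> nat) set"
  where "exponents = {e. \<forall>i. i \<notin> {1..d} \<longrightarrow> e i = 0}"

definition upset :: "(nat \<Rightarrow> nat) set \<Rightarrow> bool"
  where "upset U \<longleftrightarrow> U \<subseteq> exponents \<and> (\<forall>e\<in>U. \<forall>f\<in>exponents. e \<le> f \<longrightarrow> f \<in> U)"

abbreviation mon :: "(nat \<Rightarrow> nat) \<Rightarrow> 'a"
  where "mon \<equiv> monomial R x d"

definition gen :: "(nat \<Rightarrow> nat) set \<Rightarrow> 'a set"
  where "gen U = Idl (mon ` U)"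

abbreviation \<P> :: "'a set"
  where "\<P> \<equiv> Idl (x ` {1..d})"

definition single :: "nat \<Rightarrow> nat \<Rightarrow> nat \<Rightarrow> nat"
  where "single i n = (\<lambda>j. if j = i then n else 0)"

lemma exponents_add: "e \<in> exponents \<Longrightarrow> f \<in> exponents \<Longrightarrow> e + f \<in> exponents"
  by (simp add: exponents_def)

lemma exponents_diff: "e \<in> exponents \<Longrightarrow> e - f \<in> exponents"
  by (simp add: exponents_def)

lemma exponents_zero: "0 \<in> exponents"
  by (simp add: exponents_def)

lemma exponents_single: "i \<in> {1..d} \<Longrightarrow> single i n \<in> exponents"
  by (auto simp: exponents_def single_def)

lemma diff_add_exponents:
  fixes e f :: "nat \<Rightarrow> nat"
  shows "e \<le> f \<Longrightarrow> (f - e) + e = f"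
  by (auto simp: le_fun_def fun_eq_iff)

lemma power_x_closed: "i \<in> {1..d} \<Longrightarrow> x i [^] (n::nat) \<in> carrier R"
  using x_closed by simp

lemma mon_closed [simp]: "mon e \<in> carrier R"
  unfolding monomial_def using power_x_closed by (intro finprod_closed) auto

lemma mon_image_closed: "mon ` U \<subseteq> carrier R"
  by auto

lemma mon_add: "mon (e + f) = mon e \<otimes> mon f"
proof -
  have "mon (e + f) = (\<Otimes>i\<in>{1..d}. x i [^] e i \<otimes> x i [^] f i)"
    unfolding monomial_def using x_closed by (intro finprod_cong') (auto simp: nat_pow_mult)
  also have "\<dots> = mon e \<otimes> mon f"
    unfolding monomial_def using power_x_closed by (intro finprod_multf) auto
  finally show ?thesis .
qed

lemma mon_zero: "mon 0 = \<one>"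
  unfolding monomial_def by (simp add: finprod_one_eqI)

lemma mon_cong: "(\<And>i. i \<in> {1..d} \<Longrightarrow> e i = f i) \<Longrightarrow> mon e = mon f"
  unfolding monomial_def using power_x_closed by (intro finprod_cong') auto

lemma mon_single:
  assumes "i \<in> {1..d}"
  shows "mon (single i n) = x i [^] n"
proof -
  have "mon (single i n) = (\<Otimes>j\<in>{1..d}. if i = j then x j [^] n else \<one>)"
    unfolding monomial_def using x_closed by (intro finprod_cong') (auto simp: single_def)
  also have "\<dots> = x i [^] n"
    using finprod_singleton[OF assms, of "\<lambda>j. x j [^] n"] power_x_closed by auto
  finally show ?thesis .
qed

lemma mon_split: "e \<le> f \<Longrightarrow> mon f = mon (f - e) \<otimes> mon e"
  using mon_add[of "f - e" e] by (simp add: diff_add_exponents)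

lemma upsetD: "upset U \<Longrightarrow> e \<in> U \<Longrightarrow> f \<in> exponents \<Longrightarrow> e \<le> f \<Longrightarrow> f \<in> U"
  by (auto simp: upset_def)

lemma upset_subset: "upset U \<Longrightarrow> U \<subseteq> exponents"
  by (simp add: upset_def)

lemma upset_exponents: "upset exponents"
  by (simp add: upset_def)

lemma upset_Int: "upset U \<Longrightarrow> upset V \<Longrightarrow> upset (U \<inter> V)"
  by (auto simp: upset_def)

lemma upset_Un: "upset U \<Longrightarrow> upset V \<Longrightarrow> upset (U \<union> V)"
  by (auto simp: upset_def)

lemma upset_Inter:
  assumes "\<U> \<noteq> {}" "\<And>U. U \<in> \<U> \<Longrightarrow> upset U"
  shows "upset (\<Inter>\<U>)"
  using assms unfolding upset_def by blast

lemma gen_ideal: "ideal (gen U) R"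
  unfolding gen_def by (intro genideal_ideal mon_image_closed)

lemma gen_closed: "r \<in> gen U \<Longrightarrow> r \<in> carrier R"
  using ideal.Icarr[OF gen_ideal] .

lemma gen_least: "ideal J R \<Longrightarrow> (\<And>e. e \<in> U \<Longrightarrow> mon e \<in> J) \<Longrightarrow> gen U \<subseteq> J"
  unfolding gen_def by (intro genideal_minimal) auto

lemma mon_mem_gen: "e \<in> U \<Longrightarrow> mon e \<in> gen U"
  unfolding gen_def using genideal_self[OF mon_image_closed] by blast

lemma gen_mono: "U \<subseteq> V \<Longrightarrow> gen U \<subseteq> gen V"
  by (intro gen_least gen_ideal mon_mem_gen) auto

lemma gen_exponents: "gen exponents = carrier R"
  using ideal.one_imp_carrier[OF gen_ideal] mon_mem_gen[OF exponents_zero] by (simp add: mon_zero)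

lemma gen_mult:
  assumes "a \<in> gen U" "b \<in> gen V" "\<And>u v. u \<in> U \<Longrightarrow> v \<in> V \<Longrightarrow> u + v \<in> W"
  shows "a \<otimes> b \<in> gen W"
proof (rule genideal_mult_mem2[OF mon_image_closed mon_image_closed gen_ideal])
  show "a \<in> Idl (mon ` U)" "b \<in> Idl (mon ` V)" using assms by (auto simp: gen_def)
  show "s \<otimes> t \<in> gen W" if "s \<in> mon ` U" "t \<in> mon ` V" for s t
    using that assms(3) mon_mem_gen by (auto simp: mon_add[symmetric])
qed

lemma mem_gen_insert:
  "r \<in> gen (insert e U) \<longleftrightarrow> (\<exists>s\<in>gen U. \<exists>a\<in>carrier R. r = s \<oplus> a \<otimes> mon e)"
proof -
  have "gen (insert e U) = Idl (insert (mon e) (gen U))"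
    unfolding gen_def using genideal_insert_genideal[OF mon_image_closed mon_closed] by simp
  then show ?thesis using mem_genideal_insert[OF gen_ideal mon_closed] by simp
qed

text \<open>Every \<open>v \<in> V\<close> has an entry exceeding that of \<open>e\<close>, so that \<open>gen V \<subseteq> (x\<^sub>1\<^bsup>e\<^sub>1 + 1\<^esup>, \<dots>, x\<^sub>d\<^bsup>e\<^sub>d + 1\<^esup>)\<close>.\<close>

lemma coefficient_mem:
  assumes "a \<in> carrier R" "e \<in> exponents" "upset V" "e \<notin> V" "a \<otimes> mon e \<in> gen V"
  shows "a \<in> \<P>"
proof (rule coefficient_mem_of_finprod[of "{1..d}" "{}" a e])
  let ?S = "(\<lambda>j. x j [^] Suc (e j)) ` {1..d}"
  have S: "?S \<subseteq> carrier R" using power_x_closed by blast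
  note iS = genideal_ideal[OF S]
  have "gen V \<subseteq> Idl ?S"
  proof (rule gen_least[OF iS])
    fix v assume v: "v \<in> V"
    then have "\<not> v \<le> e" using assms(2-4) upsetD by blast
    then obtain j where j: "e j < v j" by (auto simp: le_fun_def not_le)
    have "v \<in> exponents" using v upset_subset[OF assms(3)] by blast
    then have "j \<notin> {1..d} \<Longrightarrow> v j = 0" unfolding exponents_def by blast
    then have jd: "j \<in> {1..d}" using j by (cases "j \<in> {1..d}") auto
    have "single j (Suc (e j)) \<le> v" using j by (auto simp: le_fun_def single_def)
    then have "mon v = mon (v - single j (Suc (e j))) \<otimes> x j [^] Suc (e j)"
      using mon_split mon_single[OF jd] by metis
    moreover have "x j [^] Suc (e j) \<in> Idl ?S" using genideal_self[OF S] jd by blast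
    ultimately show "mon v \<in> Idl ?S" using ideal.I_l_closed[OF iS] by simp
  qed
  then show "a \<otimes> (\<Otimes>j\<in>{1..d}. x j [^] e j) \<in> Idl (?S \<union> x ` {})"
    using assms(5) by (auto simp: monomial_def)
qed (use assms in auto)

text \<open>Counterpart of \<open>coefficient_mem\<close>: a coefficient in \<open>\<P>\<close> is a
  combination of the x_i, so its term can be pushed to the upper neighbours of e.\<close>

lemma coefficient_mult_mem:
  assumes "a \<in> \<P>" "\<And>i. i \<in> {1..d} \<Longrightarrow> e + single i 1 \<in> U"
  shows "a \<otimes> mon e \<in> gen U"
proof -
  have "mon e \<otimes> a \<in> gen U"
  proof (rule genideal_mult_mem[OF x_image_closed gen_ideal mon_closed assms(1)])
    fix s assume "s \<in> x ` {1..d}"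
    then obtain i where i: "i \<in> {1..d}" "s = x i" by auto
    then have "mon e \<otimes> s = mon (e + single i 1)" using x_closed by (simp add: mon_add mon_single)
    then show "mon e \<otimes> s \<in> gen U" using mon_mem_gen[OF assms(2)] i by simp
  qed simp
  moreover have "a \<in> carrier R" using ideal.Icarr[OF primeideal.axioms(1)[OF prime] assms(1)] .
  ultimately show ?thesis by (simp add: m_comm)
qed

lemma one_notin_prime: "\<one> \<notin> \<P>"
  using ideal.one_imp_carrier[OF primeideal.axioms(1)[OF prime]] primeideal.I_notcarr[OF prime] by auto

text \<open>The coefficient 1 is not in \<open>\<P>\<close>; thus divisibility of monomials behaves
  as in a polynomial ring.\<close>

lemma mon_mem_gen_iff:
  assumes "upset V" "e \<in> exponents"
  shows "mon e \<in> gen V \<longleftrightarrow> e \<in> V"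
  using coefficient_mem[of \<one> e V] assms one_notin_prime mon_mem_gen by auto

section \<open>Filtration by weight, Krull's theorem and intersections of monomial ideals\<close>

definition weight :: "nat set \<Rightarrow> (nat \<Rightarrow> nat) \<Rightarrow> nat"
  where "weight A e = (\<Sum>i\<in>A. e i)"

text \<open>For A inside {1..d}, \<open>gen (weight_ge A n)\<close> is the n-th power of the ideal
  P_A generated by the x_i with i in A; for A = {1..d} this gives the powers of
  \<open>\<P>\<close>.\<close>

definition weight_ge :: "nat set \<Rightarrow> nat \<Rightarrow> (nat \<Rightarrow> nat) set"
  where "weight_ge A n = {e \<in> exponents. n \<le> weight A e}"

lemma weight_add: "weight A (e + f) = weight A e + weight A f"
  by (simp add: weight_def sum.distrib)

lemma weight_mono: "e \<le> f \<Longrightarrow> weight A e \<le> weight A f"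
  by (simp add: weight_def le_fun_def sum_mono)

lemma upset_weight_ge: "upset (weight_ge A n)"
  using weight_mono by (auto simp: upset_def weight_ge_def intro: le_trans)

lemma finite_exponents_diff_weight_ge: "finite (exponents - weight_ge {1..d} n)"
proof (rule finite_subset)
  show "finite {e. \<forall>i. (i \<in> {1..d} \<longrightarrow> e i \<in> {..<n}) \<and> (i \<notin> {1..d} \<longrightarrow> e i = 0)}"
    by (rule finite_set_of_finite_funs) auto
  show "exponents - weight_ge {1..d} n \<subseteq>
    {e. \<forall>i. (i \<in> {1..d} \<longrightarrow> e i \<in> {..<n}) \<and> (i \<notin> {1..d} \<longrightarrow> e i = 0)}"
  proof
    fix e assume e: "e \<in> exponents - weight_ge {1..d} n"
    then have "weight {1..d} e < n" by (auto simp: weight_ge_def)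
    moreover have "e i \<le> weight {1..d} e" if "i \<in> {1..d}" for i
      unfolding weight_def using that by (intro member_le_sum) auto
    ultimately have "e i < n" if "i \<in> {1..d}" for i using that le_less_trans by blast
    then show "e \<in> {e. \<forall>i. (i \<in> {1..d} \<longrightarrow> e i \<in> {..<n}) \<and> (i \<notin> {1..d} \<longrightarrow> e i = 0)}"
      using e by (auto simp: exponents_def)
  qed
qed

text \<open>By Nakayama, K has to lie in each ideal L that contains \<open>gen U\<close> and x_i K
  for all i. For a primary component q of L and k in K outside q, every x_i would have a power in q.
  Then q contains all monomials of large weight, hence K, a contradiction.\<close>

lemma gen_krull:
  assumes "r \<in> carrier R" "\<And>n. r \<in> gen (U \<union> weight_ge {1..d} n)"
  shows "r \<in> gen U"
proof -
  define K where "K = carrier R \<inter> \<Inter> (range (\<lambda>n. gen (U \<union> weight_ge {1..d} n)))"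
  have K: "ideal K R" unfolding K_def by (intro Inter_ideal) (auto intro: gen_ideal)
  have "K \<subseteq> gen U"
  proof (rule nakayama[OF gen_ideal K jacobson])
    show "gen U \<subseteq> K" unfolding K_def using gen_mono[of U] gen_closed by blast
    fix L assume L: "ideal L R" "gen U \<subseteq> L" "\<And>p k. p \<in> x ` {1..d} \<Longrightarrow> k \<in> K \<Longrightarrow> p \<otimes> k \<in> L"
    obtain Q where Q: "\<forall>q\<in>Q. primary_ideal R q" "L = carrier R \<inter> \<Inter> Q"
      using primary_decomposition[OF L(1)] by auto
    have "K \<subseteq> q" if q: "q \<in> Q" for q
    proof
      fix k assume k: "k \<in> K"
      have kc: "k \<in> carrier R" using k by (simp add: K_def)
      have prim: "primary_ideal R q" and iq: "ideal q R" using Q q by (auto simp: primary_ideal_def)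
      show "k \<in> q"
      proof (rule ccontr)
        assume "k \<notin> q"
        have "\<exists>m::nat. x i [^] m \<in> q" if i: "i \<in> {1..d}" for i
        proof -
          have "x i \<otimes> k \<in> q" using L(3)[of "x i" k] i k Q(2) q by auto
          then have "k \<otimes> x i \<in> q" using m_comm kc x_closed[OF i] by simp
          then have "x i \<in> radical R q"
            using prim kc x_closed[OF i] \<open>k \<notin> q\<close> unfolding primary_ideal_def by blast
          then show ?thesis by (auto elim: radicalE)
        qed
        then obtain m :: "nat \<Rightarrow> nat" where m: "\<And>i. i \<in> {1..d} \<Longrightarrow> x i [^] m i \<in> q" by metis
        \<comment> \<open>Pigeonhole: a weight exceeding the sum of the \<open>m i\<close> forces
          some exponent above \<open>m i\<close>.\<close>
        have "gen (U \<union> weight_ge {1..d} (Suc (\<Sum>i\<in>{1..d}. m i))) \<subseteq> q"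
        proof (rule gen_least[OF iq])
          fix e assume e: "e \<in> U \<union> weight_ge {1..d} (Suc (\<Sum>i\<in>{1..d}. m i))"
          show "mon e \<in> q"
          proof (cases "e \<in> U")
            case True
            then show ?thesis using mon_mem_gen[of e U] L(2) Q(2) q by auto
          next
            case False
            then have "(\<Sum>i\<in>{1..d}. m i) < (\<Sum>i\<in>{1..d}. e i)" using e by (simp add: weight_ge_def weight_def)
            then obtain i where i: "i \<in> {1..d}" "m i < e i"
              using sum_mono[of "{1..d}" e m] by (meson not_le)
            then have "single i (m i) \<le> e" by (auto simp: le_fun_def single_def)
            then have "mon e = mon (e - single i (m i)) \<otimes> x i [^] m i"
              using mon_split mon_single[OF i(1)] by metis
            then show ?thesis using ideal.I_l_closed[OF iq m[OF i(1)]] by simp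
          qed
        qed
        then show False using k \<open>k \<notin> q\<close> by (auto simp: K_def)
      qed
    qed
    then show "K \<subseteq> L" unfolding Q(2) by (auto simp: K_def)
  qed
  then show ?thesis using assms by (auto simp: K_def)
qed

text \<open>Induction on the number of exponents missing from U, adding a maximal missing e so that
  the set stays an up-set. If e is in V, then r = s + a x^e with s in
  \<open>gen (U \<inter> V)\<close>; here a x^e is in \<open>gen U\<close>, so a is in
  \<open>\<P>\<close> and the term moves to the neighbours of e, all of which lie in both
  sets.\<close>

lemma gen_Int_cofinite:
  assumes "upset U" "upset V" "finite (exponents - U)" "r \<in> gen U" "r \<in> gen V"
  shows "r \<in> gen (U \<inter> V)"
  using assms
proof (induction "card (exponents - U)" arbitrary: U)
  case 0
  then have "U = exponents" using upset_subset[of U] by auto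
  then show ?case using 0 upset_subset[of V] by (simp add: inf_absorb2)
next
  case (Suc c)
  have "exponents - U \<noteq> {}" using Suc.hyps(2) by (metis card.empty nat.simps(3))
  from finite_has_maximal[OF Suc.prems(3) this]
  obtain e where e0: "e \<in> exponents - U" "\<forall>f\<in>exponents - U. e \<le> f \<longrightarrow> e = f" by (rule bexE)
  then have e: "e \<in> exponents" "e \<notin> U" by simp_all
  have max: "f = e \<or> f \<in> U" if f: "f \<in> exponents" "e \<le> f" for f
    using bspec[OF e0(2), of f] f by auto
  let ?T = "insert e U"
  have T: "upset ?T" using Suc.prems(1) e max unfolding upset_def by blast
  have "exponents - ?T = (exponents - U) - {e}" by blast
  then have "c = card (exponents - ?T)" "finite (exponents - ?T)"
    using Suc.hyps(2) Suc.prems(3) e by (simp_all add: card_Diff_singleton)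
  moreover have "r \<in> gen ?T" using gen_mono[of U ?T] Suc.prems(4) by auto
  ultimately have rT: "r \<in> gen (?T \<inter> V)" using Suc.hyps(1)[of ?T] T Suc.prems by auto
  show ?case
  proof (cases "e \<in> V")
    case False
    then show ?thesis using rT by simp
  next
    case True
    then have "r \<in> gen (insert e (U \<inter> V))" using rT by simp
    then obtain s a where sa: "s \<in> gen (U \<inter> V)" "a \<in> carrier R" "r = s \<oplus> a \<otimes> mon e"
      unfolding mem_gen_insert by blast
    have "s \<in> gen U" using sa(1) gen_mono[of "U \<inter> V" U] by auto
    then have "a \<otimes> mon e \<in> gen U"
      using ideal_add_cancel[OF gen_ideal, of s U "a \<otimes> mon e"] Suc.prems(4) sa by simp
    then have "a \<in> \<P>" using coefficient_mem sa(2) e Suc.prems(1) by blast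
    then have "a \<otimes> mon e \<in> gen (U \<inter> V)"
    proof (rule coefficient_mult_mem)
      fix i assume i: "i \<in> {1..d}"
      have 1: "e \<le> e + single i 1" by (simp add: le_fun_def)
      have 2: "e + single i 1 \<in> exponents" using e i by (intro exponents_add exponents_single)
      have "e + single i 1 \<noteq> e" by (auto simp: fun_eq_iff single_def)
      then have "e + single i 1 \<in> U" using max[OF 2 1] by auto
      then show "e + single i 1 \<in> U \<inter> V" using upsetD[OF Suc.prems(2) True 2 1] by auto
    qed
    then show ?thesis unfolding sa(3) using ideal_add_closed[OF gen_ideal sa(1)] by simp
  qed
qed

text \<open>Modulo large weight only finitely many exponents remain, so a finite subfamily decides;
  \<open>gen_krull\<close> then removes the bound on the weight.\<close>

lemma gen_Inter:
  assumes "\<U> \<noteq> {}" "\<And>U. U \<in> \<U> \<Longrightarrow> upset U" "\<And>U. U \<in> \<U> \<Longrightarrow> r \<in> gen U"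
  shows "r \<in> gen (\<Inter>\<U>)"
proof (rule gen_krull)
  show rc: "r \<in> carrier R" using assms gen_closed by blast
  fix n
  let ?W = "weight_ge {1..d} n"
  have fin: "r \<in> gen ((exponents \<inter> \<Inter>\<V>) \<union> ?W) \<and> upset ((exponents \<inter> \<Inter>\<V>) \<union> ?W)"
    if "finite \<V>" "\<V> \<subseteq> \<U>" for \<V>
    using that
  proof (induction \<V>)
    case empty
    have "exponents \<union> ?W = exponents" by (auto simp: weight_ge_def)
    then show ?case using rc by (simp add: gen_exponents upset_exponents)
  next
    case (insert V \<V>)
    have V: "upset V" "r \<in> gen V" using insert.prems assms by auto
    then have V': "upset (V \<union> ?W)" "r \<in> gen (V \<union> ?W)"
      using gen_mono[of V "V \<union> ?W"] by (auto intro: upset_Un upset_weight_ge)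
    have IH: "r \<in> gen ((exponents \<inter> \<Inter>\<V>) \<union> ?W)" "upset ((exponents \<inter> \<Inter>\<V>) \<union> ?W)"
      using insert by auto
    have "finite (exponents - ((exponents \<inter> \<Inter>\<V>) \<union> ?W))"
      by (rule finite_subset[OF _ finite_exponents_diff_weight_ge[of n]]) auto
    then have "r \<in> gen (((exponents \<inter> \<Inter>\<V>) \<union> ?W) \<inter> (V \<union> ?W))"
      using gen_Int_cofinite IH V' by blast
    moreover have "((exponents \<inter> \<Inter>\<V>) \<union> ?W) \<inter> (V \<union> ?W) = (exponents \<inter> \<Inter>(insert V \<V>)) \<union> ?W"
      by auto
    ultimately show ?case using upset_Int[OF IH(2) V'(1)] by simp
  qed
  let ?F = "exponents - (\<Inter>\<U> \<union> ?W)"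
  have F: "finite ?F" by (rule finite_subset[OF _ finite_exponents_diff_weight_ge[of n]]) auto
  \<comment> \<open>For each of the finitely many exponents to be excluded, one member of the family
    that omits it is selected.\<close>
  have "\<forall>e\<in>?F. \<exists>U\<in>\<U>. e \<notin> U" by auto
  then obtain u where u: "\<And>e. e \<in> ?F \<Longrightarrow> u e \<in> \<U> \<and> e \<notin> u e" by metis
  have "r \<in> gen ((exponents \<inter> \<Inter>(u ` ?F)) \<union> ?W)" using fin[of "u ` ?F"] F u by blast
  moreover have "(exponents \<inter> \<Inter>(u ` ?F)) \<union> ?W \<subseteq> \<Inter>\<U> \<union> ?W" using u by blast
  ultimately show "r \<in> gen (\<Inter>\<U> \<union> ?W)" using gen_mono by blast
qed

text \<open>The analogue of the up-closure of the exponents occurring in a polynomial. For r outside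
  the ring the family is empty and the value meaningless.\<close>

definition support :: "'a \<Rightarrow> (nat \<Rightarrow> nat) set"
  where "support r = \<Inter>{U. upset U \<and> r \<in> gen U}"

lemma
  assumes "r \<in> carrier R"
  shows upset_support: "upset (support r)" and mem_gen_support: "r \<in> gen (support r)"
proof -
  have "exponents \<in> {U. upset U \<and> r \<in> gen U}" using assms by (simp add: upset_exponents gen_exponents)
  then have ne: "{U. upset U \<and> r \<in> gen U} \<noteq> {}" by blast
  show "upset (support r)" unfolding support_def by (rule upset_Inter[OF ne]) simp
  show "r \<in> gen (support r)" unfolding support_def by (rule gen_Inter[OF ne]) simp_all
qed

lemma mem_gen_iff_support:
  assumes "r \<in> carrier R" "upset U"
  shows "r \<in> gen U \<longleftrightarrow> support r \<subseteq> U"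
  using mem_gen_support[OF assms(1)] gen_mono assms(2) by (auto simp: support_def)

text \<open>A coefficient in \<open>\<P>\<close> could be pushed to exponents strictly above e, so e
  could be deleted from the support, against its leastness.\<close>

lemma support_minimal:
  assumes r: "r \<in> carrier R" and e: "e \<in> support r" and min: "\<And>f. f \<in> support r \<Longrightarrow> f \<le> e \<Longrightarrow> f = e"
  shows "\<exists>a\<in>carrier R - \<P>. \<exists>s\<in>gen (support r - {e}). r = s \<oplus> a \<otimes> mon e"
proof -
  note up = upset_support[OF r]
  have ee: "e \<in> exponents" using e upset_subset[OF up] by auto
  have up': "upset (support r - {e})" using up min e unfolding upset_def by blast
  have "insert e (support r - {e}) = support r" using e by auto
  then have "r \<in> gen (insert e (support r - {e}))" using mem_gen_support[OF r] by simp
  then obtain s a where sa: "s \<in> gen (support r - {e})" "a \<in> carrier R" "r = s \<oplus> a \<otimes> mon e"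
    unfolding mem_gen_insert by blast
  have "a \<notin> \<P>"
  proof
    assume "a \<in> \<P>"
    then have "a \<otimes> mon e \<in> gen (support r - {e})"
    proof (rule coefficient_mult_mem)
      fix i assume i: "i \<in> {1..d}"
      have "e + single i 1 \<in> support r"
        using upsetD[OF up e exponents_add[OF ee exponents_single[OF i]]] by (simp add: le_fun_def)
      moreover have "e + single i 1 \<noteq> e" by (auto simp: fun_eq_iff single_def)
      ultimately show "e + single i 1 \<in> support r - {e}" by simp
    qed
    then have "r \<in> gen (support r - {e})" using ideal_add_closed[OF gen_ideal sa(1)] sa(3) by simp
    then have "support r \<subseteq> support r - {e}" using mem_gen_iff_support[OF r up'] by simp
    then show False using e by auto
  qed
  then show ?thesis using sa by blast
qed

text \<open>The coefficient of \<open>mon (e + f)\<close> in \<open>r \<otimes> s\<close> is, modulo \<open>\<P>\<close>, the product of those of \<open>mon e\<close> in \<open>r\<close>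
  and of \<open>mon f\<close> in \<open>s\<close>.\<close>

lemma support_mult:
  assumes r: "r \<in> carrier R" and s: "s \<in> carrier R" and e: "e \<in> support r" and f: "f \<in> support s"
    and uniq: "\<And>e' f'. e' \<in> support r \<Longrightarrow> f' \<in> support s \<Longrightarrow> e' + f' = e + f \<Longrightarrow> e' = e \<and> f' = f"
    and V: "upset V" "r \<otimes> s \<in> gen V"
  shows "e + f \<in> V"
proof (rule ccontr)
  assume n: "e + f \<notin> V"
  note upr = upset_support[OF r] and ups = upset_support[OF s]
  have ee: "e \<in> exponents" "f \<in> exponents" using e f upset_subset[OF upr] upset_subset[OF ups] by auto
  \<comment> \<open>Uniqueness extends from sums equal to e + f to sums below it: supports are
    up-sets, so the difference \<open>?g\<close> can be added to either summand. One choice gives e'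
    = e, the other f' = f.\<close>
  have shift: "e' = e \<and> f' = f"
    if ef: "e' \<in> support r" "f' \<in> support s" "e' + f' \<le> e + f" for e' f'
  proof -
    let ?g = "(e + f) - (e' + f')"
    have g: "?g \<in> exponents" using ee by (intro exponents_diff exponents_add)
    have e': "e' \<in> exponents" "f' \<in> exponents" using ef upset_subset[OF upr] upset_subset[OF ups] by auto
    have "e' + (?g + f') = e + f" "(e' + ?g) + f' = e + f"
      using diff_add_exponents[OF ef(3)] by (simp_all add: ac_simps)
    moreover have "?g + f' \<in> support s" "e' + ?g \<in> support r"
      using upsetD[OF ups ef(2) exponents_add[OF g e'(2)]] upsetD[OF upr ef(1) exponents_add[OF e'(1) g]]
      by (auto simp: le_fun_def)
    ultimately show ?thesis using uniq ef by blast
  qed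
  have "e' = e" if "e' \<in> support r" "e' \<le> e" for e'
    using shift[OF that(1) f] that(2) by (auto simp: le_fun_def)
  then obtain a r' where a: "a \<in> carrier R - \<P>" "r' \<in> gen (support r - {e})" "r = r' \<oplus> a \<otimes> mon e"
    using support_minimal[OF r e] by blast
  have "f' = f" if "f' \<in> support s" "f' \<le> f" for f'
    using shift[OF e that(1)] that(2) by (auto simp: le_fun_def)
  then obtain b s' where b: "b \<in> carrier R - \<P>" "s' \<in> gen (support s - {f})" "s = s' \<oplus> b \<otimes> mon f"
    using support_minimal[OF s f] by blast
  \<comment> \<open>The largest up-set omitting e + f. All products of terms except that of the two
    leading ones fall into \<open>gen T\<close>.\<close>
  define T where "T = {h \<in> exponents. \<not> h \<le> e + f}"
  have T: "upset T" unfolding T_def upset_def by (auto intro: order_trans)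
  have VT: "V \<subseteq> T"
    unfolding T_def using upset_subset[OF V(1)] upsetD[OF V(1) _ exponents_add[OF ee]] n by blast
  have c: "a \<in> carrier R" "b \<in> carrier R" "r' \<in> carrier R" "s' \<in> carrier R"
    using a b gen_closed by auto
  have in_T: "e' + f' \<in> T" if "e' \<in> support r" "f' \<in> support s" "e' \<noteq> e \<or> f' \<noteq> f" for e' f'
    unfolding T_def using shift[OF that(1,2)] that upset_subset[OF upr] upset_subset[OF ups]
    by (auto intro!: exponents_add)
  have 1: "r' \<otimes> s \<in> gen T"
    using gen_mult[OF a(2) mem_gen_support[OF s]] in_T by blast
  have "mon e \<otimes> s' \<in> gen T"
    by (rule gen_mult[OF mon_mem_gen[of e "{e}"] b(2)]) (use in_T e in auto)
  then have "a \<otimes> (mon e \<otimes> s') \<in> gen T" using c ideal.I_l_closed[OF gen_ideal] by blast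
  then have 2: "r' \<otimes> s \<oplus> a \<otimes> (mon e \<otimes> s') \<in> gen T" by (rule ideal_add_closed[OF gen_ideal 1])
  have "r \<otimes> s = r' \<otimes> s \<oplus> a \<otimes> mon e \<otimes> s"
    unfolding a(3) using c s mon_closed[of e] by algebra
  also have "a \<otimes> mon e \<otimes> s = a \<otimes> (mon e \<otimes> s') \<oplus> a \<otimes> b \<otimes> (mon e \<otimes> mon f)"
    unfolding b(3) using c mon_closed[of e] mon_closed[of f] by algebra
  finally have "r \<otimes> s = (r' \<otimes> s \<oplus> a \<otimes> (mon e \<otimes> s')) \<oplus> a \<otimes> b \<otimes> mon (e + f)"
    unfolding mon_add using c s mon_closed[of e] mon_closed[of f] by (simp add: a_assoc)
  moreover have "r \<otimes> s \<in> gen T" using V(2) gen_mono[OF VT] by auto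
  ultimately have "a \<otimes> b \<otimes> mon (e + f) \<in> gen T"
    using ideal_add_cancel[OF gen_ideal 2] c by simp
  then have "a \<otimes> b \<in> \<P>"
    using coefficient_mem[OF _ exponents_add[OF ee] T] c by (auto simp: T_def)
  then show False using primeideal.I_prime[OF prime c(1,2)] a b by auto
qed

end

subsection \<open>Products and integral dependence\<close>

lemma exists_minimizer:
  fixes w :: "'e \<Rightarrow> nat"
  assumes "M \<noteq> {}"
  shows "\<exists>a\<in>M. \<forall>a'\<in>M. w a \<le> w a'"
  using ex_has_least_nat[of "\<lambda>a. a \<in> M" _ w] assms by blast

text \<open>Lexicographic minimization: each functional is minimized over the minimizers of the
  preceding ones. Additivity forces every other decomposition of a + b to consist of minimizers too.
  Only the first functional is minimal over all of M and N; \<open>take 1\<close> states this also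
  for the empty list.\<close>

lemma exists_unique_sum:
  fixes ws :: "('e::plus \<Rightarrow> nat) list"
  assumes "\<And>w a b. w \<in> set ws \<Longrightarrow> w (a + b) = w a + w b" "M \<noteq> {}" "N \<noteq> {}"
  shows "\<exists>a\<in>M. \<exists>b\<in>N. (\<forall>w\<in>set (take 1 ws). (\<forall>a'\<in>M. w a \<le> w a') \<and> (\<forall>b'\<in>N. w b \<le> w b')) \<and>
    (\<forall>a'\<in>M. \<forall>b'\<in>N. a' + b' = a + b \<longrightarrow> (\<forall>w\<in>set ws. w a' = w a \<and> w b' = w b))"
  using assms
proof (induction ws arbitrary: M N)
  case Nil
  then show ?case by auto
next
  case (Cons w ws)
  define M' where "M' = {a \<in> M. \<forall>a'\<in>M. w a \<le> w a'}"
  define N' where "N' = {b \<in> N. \<forall>b'\<in>N. w b \<le> w b'}"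
  have "M' \<noteq> {}" "N' \<noteq> {}"
    using exists_minimizer[OF Cons.prems(2), of w] exists_minimizer[OF Cons.prems(3), of w]
    by (auto simp: M'_def N'_def)
  then obtain a b where ab: "a \<in> M'" "b \<in> N'"
    and uniq: "\<And>a' b' v. a' \<in> M' \<Longrightarrow> b' \<in> N' \<Longrightarrow> a' + b' = a + b \<Longrightarrow> v \<in> set ws \<Longrightarrow> v a' = v a \<and> v b' = v b"
    using Cons.IH[of M' N'] Cons.prems(1) by (metis list.set_intros(2))
  have min: "w a \<le> w a'" "w b \<le> w b'" if "a' \<in> M" "b' \<in> N" for a' b'
    using ab that by (auto simp: M'_def N'_def)
  have "v a' = v a \<and> v b' = v b"
    if s: "a' \<in> M" "b' \<in> N" "a' + b' = a + b" "v \<in> set (w # ws)" for a' b' v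
  proof -
    have "w a' + w b' = w a + w b" using s(3) Cons.prems(1)[of w] by (metis list.set_intros(1))
    then have e: "w a' = w a" "w b' = w b" using min[OF s(1,2)] by auto
    then have "a' \<in> M'" "b' \<in> N'" using s ab by (auto simp: M'_def N'_def)
    then show ?thesis using e uniq s(3,4) by auto
  qed
  moreover have "a \<in> M" "b \<in> N" using ab by (auto simp: M'_def N'_def)
  ultimately show ?case using min by (intro bexI[of _ a] bexI[of _ b]) auto
qed

lemma (in cring) finsum_mem_ideal:
  assumes "ideal J R" "finite A" "\<And>i. i \<in> A \<Longrightarrow> f i \<in> J"
  shows "finsum R f A \<in> J"
  using assms(2,3)
proof (induction A)
  case empty
  then show ?case using additive_subgroup.zero_closed[OF ideal.axioms(1)[OF assms(1)]] by simp
next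
  case (insert i A)
  have "f \<in> A \<rightarrow> carrier R" "f i \<in> carrier R" using insert.prems ideal.Icarr[OF assms(1)] by auto
  then show ?case using insert ideal_add_closed[OF assms(1)] by simp
qed

lemma (in cring) primeideal_finprodD:
  assumes "primeideal P R" "finite A" "f \<in> A \<rightarrow> carrier R" "finprod R f A \<in> P"
  shows "\<exists>i\<in>A. f i \<in> P"
  using assms(2-4)
proof (induction A)
  case empty
  then show ?case
    using ideal.one_imp_carrier[OF primeideal.axioms(1)[OF assms(1)]] primeideal.I_notcarr[OF assms(1)] by auto
next
  case (insert i A)
  have f: "f \<in> A \<rightarrow> carrier R" "f i \<in> carrier R" using insert.prems by auto
  then have "f i \<otimes> finprod R f A \<in> P" using insert by simp
  then have "f i \<in> P \<or> finprod R f A \<in> P"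
    using primeideal.I_prime[OF assms(1) f(2)] finprod_closed[OF f(1)] by blast
  then show ?case using insert.IH f(1) by auto
qed

context prime_regular_sequence
begin

text \<open>The A-weight is minimized first; the coordinates 1 to d break ties and, taken together,
  separate exponents.\<close>

lemma exists_unique_exponent_sum:
  assumes "M \<subseteq> exponents" "N \<subseteq> exponents" "M \<noteq> {}" "N \<noteq> {}"
  obtains e f where "e \<in> M" "f \<in> N"
    "\<And>e'. e' \<in> M \<Longrightarrow> weight A e \<le> weight A e'" "\<And>f'. f' \<in> N \<Longrightarrow> weight A f \<le> weight A f'"
    "\<And>e' f'. e' \<in> M \<Longrightarrow> f' \<in> N \<Longrightarrow> e' + f' = e + f \<Longrightarrow> e' = e \<and> f' = f"
proof -
  let ?ws = "weight A # map (\<lambda>i e. e i) [1..<Suc d]"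
  have add: "w (a + b) = w a + w b" if "w \<in> set ?ws" for w a b
    using that by (auto simp: weight_add)
  obtain e f where ef: "e \<in> M" "f \<in> N"
    "\<forall>w\<in>set (take 1 ?ws). (\<forall>e'\<in>M. w e \<le> w e') \<and> (\<forall>f'\<in>N. w f \<le> w f')"
    "\<forall>e'\<in>M. \<forall>f'\<in>N. e' + f' = e + f \<longrightarrow> (\<forall>w\<in>set ?ws. w e' = w e \<and> w f' = w f)"
    using exists_unique_sum[of ?ws M N, OF add assms(3,4)] by blast
  have eq: "e' = e \<and> f' = f" if s: "e' \<in> M" "f' \<in> N" "e' + f' = e + f" for e' f'
  proof -
    have "e' i = e i \<and> f' i = f i" for i
    proof (cases "i \<in> {1..d}")
      case True
      then have "i \<in> set [1..<Suc d]" by auto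
      then have i: "(\<lambda>e. e i) \<in> set ?ws" by (metis (no_types, lifting) image_eqI list.set_intros(2) set_map)
      have "\<forall>w\<in>set ?ws. w e' = w e \<and> w f' = w f" using ef(4) s by blast
      from bspec[OF this i] show ?thesis .
    next
      case False
      have "e' \<in> exponents" "e \<in> exponents" "f' \<in> exponents" "f \<in> exponents"
        using s ef(1,2) assms by auto
      then show ?thesis using False unfolding exponents_def by (metis (mono_tags, lifting) mem_Collect_eq)
    qed
    then show ?thesis by (simp add: fun_eq_iff)
  qed
  show thesis by (rule that[OF ef(1,2)]) (use ef(3) eq in auto)
qed

text \<open>Elements outside P_A are nonzerodivisors modulo \<open>gen V\<close> if V is stable
  under cancelling exponents of A-weight zero. Such an s has an exponent of A-weight zero in its
  support, so the minimizing f has weight zero and can be cancelled from e + f.\<close>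

lemma mult_notin_gen:
  assumes r: "r \<in> carrier R" "r \<notin> gen V" and s: "s \<in> carrier R" "s \<notin> gen (weight_ge A 1)"
    and V: "upset V"
    and cancel: "\<And>e f. e \<in> exponents \<Longrightarrow> f \<in> exponents \<Longrightarrow> weight A f = 0 \<Longrightarrow> e + f \<in> V \<Longrightarrow> e \<in> V"
  shows "r \<otimes> s \<notin> gen V"
proof
  assume rs: "r \<otimes> s \<in> gen V"
  note upr = upset_support[OF r(1)] and ups = upset_support[OF s(1)]
  have "support r - V \<noteq> {}" using r mem_gen_iff_support[OF r(1) V] by auto
  moreover obtain f0 where f0: "f0 \<in> support s" "f0 \<notin> weight_ge A 1"
    using s mem_gen_iff_support[OF s(1) upset_weight_ge] by auto
  moreover have "support r - V \<subseteq> exponents" "support s \<subseteq> exponents"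
    using upset_subset[OF upr] upset_subset[OF ups] by auto
  ultimately obtain e f where ef: "e \<in> support r - V" "f \<in> support s"
    and min: "\<And>f'. f' \<in> support s \<Longrightarrow> weight A f \<le> weight A f'"
    and uniq: "\<And>e' f'. e' \<in> support r - V \<Longrightarrow> f' \<in> support s \<Longrightarrow> e' + f' = e + f \<Longrightarrow> e' = e \<and> f' = f"
    using exists_unique_exponent_sum[of "support r - V" "support s" A] by (metis empty_iff)
  have exps: "e \<in> exponents" "f \<in> exponents" "f0 \<in> exponents"
    using ef f0 upset_subset[OF upr] upset_subset[OF ups] by auto
  have "weight A f0 = 0" using f0 exps by (simp add: weight_ge_def)
  then have wf: "weight A f = 0" using min[OF f0(1)] by simp
  have "e + f \<in> V"
  proof (rule support_mult[OF r(1) s(1) _ ef(2) _ V rs])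
    show "e \<in> support r" using ef by simp
    fix e' f' assume s: "e' \<in> support r" "f' \<in> support s" "e' + f' = e + f"
    \<comment> \<open>Uniqueness is known only for exponents of r outside V. An e' in V would place
      e + f, hence e by cancellation, in V.\<close>
    have "e' \<notin> V"
    proof
      assume "e' \<in> V"
      then have "e + f \<in> V"
        using upsetD[OF V _ exponents_add[OF exps(1,2)]] s(3)[symmetric] by (simp add: le_fun_def)
      then show False using cancel exps wf ef by blast
    qed
    then show "e' = e \<and> f' = f" using uniq s by blast
  qed
  then show False using cancel exps wf ef by blast
qed

text \<open>The order with respect to P_A is additive: orders at most m and n give order at most m +
  n, since the minimal weights add up. The case m = n = 0 is the primality of P_A.\<close>

lemma mult_notin_gen_weight_ge:
  assumes r: "r \<in> carrier R" "r \<notin> gen (weight_ge A (Suc m))"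
    and s: "s \<in> carrier R" "s \<notin> gen (weight_ge A (Suc n))"
  shows "r \<otimes> s \<notin> gen (weight_ge A (Suc (m + n)))"
proof
  assume rs: "r \<otimes> s \<in> gen (weight_ge A (Suc (m + n)))"
  note upr = upset_support[OF r(1)] and ups = upset_support[OF s(1)]
  obtain e0 where e0: "e0 \<in> support r" "e0 \<notin> weight_ge A (Suc m)"
    using r mem_gen_iff_support[OF r(1) upset_weight_ge] by auto
  obtain f0 where f0: "f0 \<in> support s" "f0 \<notin> weight_ge A (Suc n)"
    using s mem_gen_iff_support[OF s(1) upset_weight_ge] by auto
  have "support r \<noteq> {}" "support s \<noteq> {}" using e0 f0 by auto
  then obtain e f where ef: "e \<in> support r" "f \<in> support s"
    and min: "\<And>e'. e' \<in> support r \<Longrightarrow> weight A e \<le> weight A e'"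
      "\<And>f'. f' \<in> support s \<Longrightarrow> weight A f \<le> weight A f'"
    and uniq: "\<And>e' f'. e' \<in> support r \<Longrightarrow> f' \<in> support s \<Longrightarrow> e' + f' = e + f \<Longrightarrow> e' = e \<and> f' = f"
    using exists_unique_exponent_sum[OF upset_subset[OF upr] upset_subset[OF ups], of A] by blast
  have "e + f \<in> weight_ge A (Suc (m + n))"
    by (rule support_mult[OF r(1) s(1) ef uniq upset_weight_ge rs])
  then have "Suc (m + n) \<le> weight A e + weight A f" by (simp add: weight_ge_def weight_add)
  moreover have "e0 \<in> exponents" "f0 \<in> exponents"
    using e0 f0 upset_subset[OF upr] upset_subset[OF ups] by auto
  then have "weight A e0 \<le> m" "weight A f0 \<le> n" using e0 f0 by (auto simp: weight_ge_def)
  ultimately show False using min(1)[OF e0(1)] min(2)[OF f0(1)] by simp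
qed

lemma upset_nonzero_gen_ne_carrier:
  assumes "upset V" "0 \<notin> V"
  shows "gen V \<noteq> carrier R"
  using mon_mem_gen_iff[OF assms(1) exponents_zero] assms(2) mon_zero one_closed by metis

lemma primeideal_gen_weight_ge: "primeideal (gen (weight_ge A 1)) R"
proof (rule primeidealI[OF gen_ideal is_cring])
  have "0 \<notin> weight_ge A 1" by (simp add: weight_ge_def weight_def)
  then show "carrier R \<noteq> gen (weight_ge A 1)" using upset_nonzero_gen_ne_carrier[OF upset_weight_ge] by metis
  fix a b assume ab: "a \<in> carrier R" "b \<in> carrier R" "a \<otimes> b \<in> gen (weight_ge A 1)"
  show "a \<in> gen (weight_ge A 1) \<or> b \<in> gen (weight_ge A 1)"
    using mult_notin_gen_weight_ge[of a A 0 b 0] ab by auto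
qed

lemma weight_single: "finite A \<Longrightarrow> i \<in> A \<Longrightarrow> weight A (single i n) = n"
  by (simp add: weight_def single_def)

lemma ideal_power_gen_weight_ge:
  assumes A: "A \<subseteq> {1..d}"
  shows "ideal_power R (gen (weight_ge A 1)) n = gen (weight_ge A n)"
proof (induction n)
  case 0
  then show ?case by (simp add: gen_exponents[symmetric] weight_ge_def)
next
  case (Suc n)
  have fin: "finite A" using A finite_subset by blast
  show ?case
  proof (rule equalityI)
    show "ideal_power R (gen (weight_ge A 1)) (Suc n) \<subseteq> gen (weight_ge A (Suc n))"
      unfolding ideal_power_Suc Suc.IH
      by (rule ideal_prod_subset[OF gen_ideal], erule gen_mult, assumption)
        (auto simp: weight_ge_def weight_add exponents_add)
    show "gen (weight_ge A (Suc n)) \<subseteq> ideal_power R (gen (weight_ge A 1)) (Suc n)"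
    proof (rule gen_least[OF ideal_power_ideal[OF gen_ideal]])
      fix e assume e: "e \<in> weight_ge A (Suc n)"
      then have "weight A e \<noteq> 0" by (simp add: weight_ge_def)
      then obtain i where i: "i \<in> A" "e i \<noteq> 0" unfolding weight_def by (metis sum.neutral)
      have id: "i \<in> {1..d}" using i A by auto
      have le: "single i 1 \<le> e" using i by (auto simp: le_fun_def single_def)
      have "weight A (e - single i 1) + weight A (single i 1) = weight A e"
        unfolding weight_add[symmetric] diff_add_exponents[OF le] ..
      then have "e - single i 1 \<in> weight_ge A n"
        using e weight_single[OF fin i(1)] by (simp add: weight_ge_def exponents_diff)
      moreover have "single i 1 \<in> weight_ge A 1"
        using weight_single[OF fin i(1)] exponents_single[OF id] by (simp add: weight_ge_def)
      ultimately show "mon e \<in> ideal_power R (gen (weight_ge A 1)) (Suc n)"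
        unfolding ideal_power_Suc Suc.IH mon_split[OF le] by (intro ideal_prod.prod mon_mem_gen)
    qed
  qed
qed

lemma ideal_power_gen:
  assumes "upset U"
  shows "\<exists>W. upset W \<and> ideal_power R (gen U) n = gen W"
proof (induction n)
  case 0
  then show ?case using upset_exponents by (auto simp: gen_exponents intro!: exI[of _ exponents])
next
  case (Suc n)
  then obtain W where W: "upset W" "ideal_power R (gen U) n = gen W" by auto
  let ?T = "{w + u | w u. w \<in> W \<and> u \<in> U}"
  have "upset ?T"
    unfolding upset_def
  proof (intro conjI ballI impI subsetI)
    fix e assume "e \<in> ?T"
    then show "e \<in> exponents" using upset_subset[OF W(1)] upset_subset[OF assms] by (auto intro!: exponents_add)
  next
    fix e f assume "e \<in> ?T" and f: "f \<in> exponents" "e \<le> f"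
    then obtain w u where wu: "w \<in> W" "u \<in> U" "e = w + u" by auto
    have "w + (f - e) \<in> W"
      using upsetD[OF W(1) wu(1) exponents_add[OF _ exponents_diff[OF f(1)]]] wu(1) upset_subset[OF W(1)]
      by (auto simp: le_fun_def)
    moreover have "f = (w + (f - e)) + u" using diff_add_exponents[OF f(2)] wu(3) by (simp add: ac_simps)
    ultimately show "f \<in> ?T" using wu(2) by blast
  qed
  moreover have "ideal_power R (gen U) (Suc n) = gen ?T"
    unfolding ideal_power_Suc W(2)
  proof (rule equalityI)
    show "ideal_prod R (gen W) (gen U) \<subseteq> gen ?T"
      by (rule ideal_prod_subset[OF gen_ideal], erule gen_mult, assumption) auto
    show "gen ?T \<subseteq> ideal_prod R (gen W) (gen U)"
      by (rule gen_least[OF ideal_prod_is_ideal[OF gen_ideal gen_ideal]])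
        (auto simp: mon_add intro!: ideal_prod.prod mon_mem_gen)
  qed
  ultimately show ?case by blast
qed

section \<open>Monomial ideals as up-sets, their minimal primes and localizations\<close>

lemma mon_restrict: "\<exists>f\<in>exponents. mon e = mon f \<and> (\<forall>i\<in>{1..d}. f i = e i)"
proof -
  let ?f = "\<lambda>i. if i \<in> {1..d} then e i else 0"
  have "?f \<in> exponents" by (auto simp: exponents_def)
  moreover have "mon e = mon ?f" by (rule mon_cong) auto
  ultimately show ?thesis by (intro bexI[of _ ?f]) auto
qed

lemma upset_exponents_of_ideal:
  assumes "ideal J R"
  shows "upset {e \<in> exponents. mon e \<in> J}"
  unfolding upset_def using mon_split ideal.I_l_closed[OF assms] by auto

lemma genideal_monomials_eq_gen:
  assumes "S \<subseteq> monomials R x d" "I = Idl S"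
  shows "I = gen {e \<in> exponents. mon e \<in> I}"
proof (rule equalityI)
  have S: "S \<subseteq> carrier R" using assms(1) by (auto simp: monomials_def)
  have I: "ideal I R" unfolding assms(2) by (rule genideal_ideal[OF S])
  show "gen {e \<in> exponents. mon e \<in> I} \<subseteq> I" by (rule gen_least[OF I]) simp
  have "S \<subseteq> gen {e \<in> exponents. mon e \<in> I}"
  proof
    fix s assume s: "s \<in> S"
    then obtain e where "s = mon e" using assms(1) by (auto simp: monomials_def)
    then obtain f where f: "f \<in> exponents" "s = mon f" using mon_restrict by metis
    then have "mon f \<in> I" using s genideal_self[OF S] assms(2) by auto
    then show "s \<in> gen {e \<in> exponents. mon e \<in> I}" using f by (auto intro: mon_mem_gen)
  qed
  then show "I \<subseteq> gen {e \<in> exponents. mon e \<in> I}" unfolding assms(2) by (rule genideal_minimal[OF gen_ideal])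
qed

lemma monomial_ideal_gen:
  assumes "upset U" "gen U \<noteq> carrier R"
  shows "monomial_ideal R x d (gen U)"
proof -
  have "mon ` U \<subseteq> monomials R x d" by (auto simp: monomials_def)
  then show ?thesis unfolding monomial_ideal_def using assms(2) by (auto simp: gen_def)
qed

text \<open>For each monomial x^e outside I there is a prime P_A containing I but not x^e. If r^n is
  in I, then r lies in all these primes, so no such e can occur in its support.\<close>

lemma squarefree_monomial_ideal_radical:
  assumes "squarefree_monomial_ideal R x d I"
  shows "radical R I \<subseteq> I"
proof
  obtain S where S: "S \<subseteq> squarefree_monomials R x d" "I = Idl S"
    using assms by (auto simp: squarefree_monomial_ideal_def)
  have S': "S \<subseteq> monomials R x d" using S(1) by (auto simp: squarefree_monomials_def monomials_def)
  have Sc: "S \<subseteq> carrier R" using S' by (auto simp: monomials_def)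
  have I: "ideal I R" unfolding S(2) by (rule genideal_ideal[OF Sc])
  let ?U = "{e \<in> exponents. mon e \<in> I}"
  have U: "upset ?U" by (rule upset_exponents_of_ideal[OF I])
  have IU: "I = gen ?U" by (rule genideal_monomials_eq_gen[OF S' S(2)])
  fix r assume "r \<in> radical R I"
  then obtain n :: nat where n: "r [^] n \<in> I" "r \<in> carrier R" by (rule radicalE)
  have "support r \<subseteq> ?U"
  proof (rule ccontr)
    assume "\<not> support r \<subseteq> ?U"
    then obtain e where e: "e \<in> support r" "e \<notin> ?U" by auto
    have ee: "e \<in> exponents" using e upset_subset[OF upset_support[OF n(2)]] by auto
    \<comment> \<open>The variables absent from x^e. A squarefree generator that does not divide x^e
      must involve one of them, because an exponent 1 exceeds \<open>e i\<close> only when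
      \<open>e i = 0\<close>.\<close>
    define A where "A = {i \<in> {1..d}. e i = 0}"
    have "S \<subseteq> gen (weight_ge A 1)"
    proof
      fix s assume s: "s \<in> S"
      then obtain g where g: "s = mon g" "\<forall>i\<in>{1..d}. g i \<in> {0, 1}"
        using S(1) by (auto simp: squarefree_monomials_def)
      obtain f where f: "f \<in> exponents" "s = mon f" "\<forall>i\<in>{1..d}. f i \<in> {0, 1}"
        using mon_restrict[of g] g by metis
      have "f \<in> ?U" using f s genideal_self[OF Sc] S(2) by auto
      then have "\<not> f \<le> e" using upsetD[OF U _ ee] e(2) by blast
      then obtain i where i: "e i < f i" by (auto simp: le_fun_def not_le)
      have "i \<in> {1..d}"
      proof (rule ccontr)
        assume "i \<notin> {1..d}"
        then have "f i = 0" using f(1) unfolding exponents_def by blast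
        then show False using i by simp
      qed
      moreover from this have "f i = 0 \<or> f i = 1" using bspec[OF f(3), of i] by auto
      ultimately have "f i = 1" "i \<in> A" using i by (auto simp: A_def)
      moreover have "f i \<le> weight A f" unfolding weight_def using \<open>i \<in> A\<close>
        by (intro member_le_sum) (auto simp: A_def)
      ultimately have "f \<in> weight_ge A 1" using f(1) by (simp add: weight_ge_def)
      then show "s \<in> gen (weight_ge A 1)" unfolding f(2) by (rule mon_mem_gen)
    qed
    then have "I \<subseteq> gen (weight_ge A 1)" unfolding S(2) by (rule genideal_minimal[OF gen_ideal])
    then have "r \<in> gen (weight_ge A 1)"
      using primeideal_powerD[OF primeideal_gen_weight_ge n(2)] n(1) by auto
    then have "e \<in> weight_ge A 1" using e(1) mem_gen_iff_support[OF n(2) upset_weight_ge] by auto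
    then show False by (auto simp: weight_ge_def weight_def A_def)
  qed
  then show "r \<in> I" using mem_gen_iff_support[OF n(2) U] IU by auto
qed

text \<open>A collects the variables lying in P. A monomial in P has a variable factor in P, so
  \<open>gen U\<close> is inside P_A and P_A inside P; as P_A is prime, minimality of P gives
  equality.\<close>

lemma mAss_gen:
  assumes "P \<in> mAss R (quot_module R (gen U))"
  obtains A where "A \<subseteq> {1..d}" "P = gen (weight_ge A 1)"
proof -
  note P = mAss_quot_moduleD[OF gen_ideal assms]
  define A where "A = {i \<in> {1..d}. x i \<in> P}"
  have nz: "\<exists>i\<in>A. u i \<noteq> 0" if u: "mon u \<in> P" for u
  proof -
    obtain i where i: "i \<in> {1..d}" "x i [^] u i \<in> P"
      using primeideal_finprodD[OF P(1), of "{1..d}" "\<lambda>i. x i [^] u i"] u power_x_closed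
      by (auto simp: monomial_def)
    then have "x i \<in> P" using primeideal_powerD[OF P(1)] x_closed by blast
    moreover have "u i \<noteq> 0"
    proof
      assume "u i = 0"
      then have "\<one> \<in> P" using i by simp
      then show False
        using ideal.one_imp_carrier[OF primeideal.axioms(1)[OF P(1)]] primeideal.I_notcarr[OF P(1)] by simp
    qed
    ultimately show ?thesis using i by (auto simp: A_def)
  qed
  have "gen (weight_ge A 1) \<subseteq> P"
  proof (rule gen_least[OF primeideal.axioms(1)[OF P(1)]])
    fix e assume "e \<in> weight_ge A 1"
    then have "weight A e \<noteq> 0" by (simp add: weight_ge_def)
    then obtain i where i: "i \<in> A" "e i \<noteq> 0" unfolding weight_def by (metis sum.neutral)
    then have id: "i \<in> {1..d}" "x i \<in> P" by (auto simp: A_def)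
    have le: "single i 1 \<le> e" using i by (auto simp: le_fun_def single_def)
    show "mon e \<in> P" unfolding mon_split[OF le] mon_single[OF id(1)]
      using ideal.I_l_closed[OF primeideal.axioms(1)[OF P(1)]] id x_closed by simp
  qed
  moreover have "gen U \<subseteq> gen (weight_ge A 1)"
  proof (rule gen_least[OF gen_ideal])
    fix u assume "u \<in> U"
    then have "mon u \<in> P" using mon_mem_gen P(2) by blast
    obtain v where v: "v \<in> exponents" "mon u = mon v" using mon_restrict by metis
    then obtain i where i: "i \<in> A" "v i \<noteq> 0" using nz \<open>mon u \<in> P\<close> by metis
    have "v i \<le> weight A v" unfolding weight_def using i(1) by (intro member_le_sum) (auto simp: A_def)
    then have "v \<in> weight_ge A 1" using i v by (simp add: weight_ge_def)
    then show "mon u \<in> gen (weight_ge A 1)" unfolding v(2) by (rule mon_mem_gen)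
  qed
  ultimately have "gen (weight_ge A 1) = P"
    using mAss_minimal[OF gen_ideal assms primeideal_gen_weight_ge] by blast
  moreover have "A \<subseteq> {1..d}" by (auto simp: A_def)
  ultimately show thesis using that by blast
qed

text \<open>Localizing at P_A inverts the variables outside A. So \<open>?V\<close> collects the
  exponents that enter V after adding an exponent of A-weight zero, and it has the cancellation
  property required by \<open>mult_notin_gen\<close>.\<close>

lemma saturation_gen:
  assumes "upset V"
  shows "\<exists>V'. upset V' \<and> saturation R (gen (weight_ge A 1)) (gen V) = gen V'"
proof -
  let ?P = "gen (weight_ge A 1)"
  let ?V = "{e \<in> exponents. \<exists>f\<in>exponents. weight A f = 0 \<and> e + f \<in> V}"
  have up: "upset ?V"
    unfolding upset_def
  proof (intro conjI ballI impI)
    fix e e' assume "e \<in> ?V" and e': "e' \<in> exponents" "e \<le> e'"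
    then obtain f where f: "f \<in> exponents" "weight A f = 0" "e + f \<in> V" by auto
    have "e' + f \<in> V" using upsetD[OF assms f(3) exponents_add[OF e'(1) f(1)]] e'(2) by (simp add: le_fun_def)
    then show "e' \<in> ?V" using e' f by auto
  qed auto
  have cancel: "e \<in> ?V" if ef: "e \<in> exponents" "f \<in> exponents" "weight A f = 0" "e + f \<in> ?V" for e f
  proof -
    obtain g where "g \<in> exponents" "weight A g = 0" "e + (f + g) \<in> V" using ef(4) by (auto simp: add.assoc)
    then show ?thesis using ef exponents_add weight_add by (intro CollectI conjI bexI[of _ "f + g"]) auto
  qed
  have "saturation R ?P (gen V) = gen ?V"
  proof (rule equalityI)
    have VV: "V \<subseteq> ?V"
    proof
      fix e assume "e \<in> V"
      then show "e \<in> ?V" using upset_subset[OF assms] exponents_zero by (auto simp: weight_def intro!: bexI[of _ 0])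
    qed
    show "saturation R ?P (gen V) \<subseteq> gen ?V"
    proof
      fix r assume "r \<in> saturation R ?P (gen V)"
      then obtain s where s: "r \<in> carrier R" "s \<in> carrier R" "s \<notin> ?P" "s \<otimes> r \<in> gen V"
        by (auto simp: saturation_def)
      have "s \<otimes> r \<in> gen ?V" by (rule subsetD[OF gen_mono[OF VV] s(4)])
      then have rs: "r \<otimes> s \<in> gen ?V" using m_comm s(1,2) by simp
      show "r \<in> gen ?V"
      proof (rule ccontr)
        assume "r \<notin> gen ?V"
        from mult_notin_gen[OF s(1) this s(2,3) up cancel] show False using rs by simp
      qed
    qed
    show "gen ?V \<subseteq> saturation R ?P (gen V)"
    proof (rule gen_least[OF saturation_ideal[OF primeideal_gen_weight_ge gen_ideal]])
      fix e assume "e \<in> ?V"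
      then obtain f where f: "f \<in> exponents" "weight A f = 0" "e + f \<in> V" by auto
      have "mon f \<otimes> mon e \<in> gen V"
        using mon_mem_gen[OF f(3)] by (simp add: mon_add m_comm)
      moreover have "mon f \<notin> ?P" using mon_mem_gen_iff[OF upset_weight_ge f(1)] f(2) by (simp add: weight_ge_def)
      ultimately show "mon e \<in> saturation R ?P (gen V)" by (auto simp: saturation_def)
    qed
  qed
  then show ?thesis using up by blast
qed

lemma symbolic_power_monomial_ideal:
  assumes I: "monomial_ideal R x d I" and k: "k \<ge> 1"
  shows "monomial_ideal R x d (symbolic_power R I k)"
proof -
  obtain S where S: "I \<noteq> carrier R" "S \<subseteq> monomials R x d" "I = Idl S"
    using I by (auto simp: monomial_ideal_def)
  have Sc: "S \<subseteq> carrier R" using S by (auto simp: monomials_def)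
  have iI: "ideal I R" unfolding S(3) by (rule genideal_ideal[OF Sc])
  let ?U = "{e \<in> exponents. mon e \<in> I}"
  have U: "upset ?U" by (rule upset_exponents_of_ideal[OF iI])
  have IU: "I = gen ?U" by (rule genideal_monomials_eq_gen[OF S(2,3)])
  obtain W where W: "upset W" "ideal_power R I k = gen W" using ideal_power_gen[OF U] IU by metis
  let ?M = "mAss R (quot_module R I)"
  have "\<exists>V. upset V \<and> saturation R P (ideal_power R I k) = gen V" if P: "P \<in> ?M" for P
  proof -
    obtain A where "P = gen (weight_ge A 1)" using mAss_gen[of P ?U] P IU by metis
    then show ?thesis using saturation_gen[OF W(1), of A] W(2) by simp
  qed
  then obtain v where v: "\<And>P. P \<in> ?M \<Longrightarrow> upset (v P) \<and> saturation R P (ideal_power R I k) = gen (v P)"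
    by metis
  have ne: "?M \<noteq> {}" by (rule mAss_nonempty[OF iI S(1)])
  have up: "upset (\<Inter>(v ` ?M))" using ne v by (intro upset_Inter) auto
  have sym: "symbolic_power R I k = carrier R \<inter> (\<Inter>P\<in>?M. gen (v P))"
    unfolding symbolic_power_eq[OF iI k] using v by simp
  have eq: "symbolic_power R I k = gen (\<Inter>(v ` ?M))"
  proof (intro equalityI subsetI)
    fix r assume "r \<in> symbolic_power R I k"
    then have "r \<in> gen V" if "V \<in> v ` ?M" for V using that unfolding sym by auto
    then show "r \<in> gen (\<Inter>(v ` ?M))" using gen_Inter[of "v ` ?M" r] ne v by blast
  next
    fix r assume r: "r \<in> gen (\<Inter>(v ` ?M))"
    then have "r \<in> gen (v P)" if "P \<in> ?M" for P using gen_mono[of "\<Inter>(v ` ?M)" "v P"] that by auto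
    then show "r \<in> symbolic_power R I k" unfolding sym using gen_closed[OF r] by simp
  qed
  \<comment> \<open>If 1 were in the saturation at P, some s outside P would lie in I^k, which is
    contained in P.\<close>
  have "symbolic_power R I k \<noteq> carrier R"
  proof
    assume c: "symbolic_power R I k = carrier R"
    obtain P where P: "P \<in> ?M" using ne by auto
    have "\<one> \<in> symbolic_power R I k" using c by simp
    then have "\<one> \<in> saturation R P (ideal_power R I k)"
      unfolding symbolic_power_eq[OF iI k] using P by blast
    then obtain s where "s \<in> carrier R - P" "s \<in> ideal_power R I k" by (auto simp: saturation_def)
    then show False using ideal_power_subset[OF iI k] mAss_quot_moduleD(2)[OF iI P] by auto
  qed
  then show ?thesis using monomial_ideal_gen[OF up] eq by simp
qed

text \<open>Valuation argument: let r have order j < n with respect to P_A. Then r^m has order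
  exactly j m, whereas every other term of the integral equation has larger order.\<close>

lemma integral_closure_gen_weight_ge:
  assumes A: "A \<subseteq> {1..d}"
  shows "integral_closure R (gen (weight_ge A n)) \<subseteq> gen (weight_ge A n)"
proof (rule subsetI, rule ccontr)
  fix r assume "r \<in> integral_closure R (gen (weight_ge A n))" and notin: "r \<notin> gen (weight_ge A n)"
  then obtain m c where m: "m \<ge> 1" and r: "r \<in> carrier R"
    and c: "\<And>i. i \<in> {1..m} \<Longrightarrow> c i \<in> ideal_power R (gen (weight_ge A n)) i"
    and eq: "r [^] m \<oplus> (\<Oplus>i\<in>{1..m}. c i \<otimes> r [^] (m - i)) = \<zero>"
    unfolding integral_closure_def by blast
  have pow: "ideal_power R (gen (weight_ge A a)) i \<subseteq> gen (weight_ge A (a * i))" for a i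
  proof (induction i)
    case 0
    then show ?case by (simp add: gen_exponents[symmetric] weight_ge_def)
  next
    case (Suc i)
    show ?case unfolding ideal_power_Suc
    proof (rule ideal_prod_subset[OF gen_ideal])
      fix s t assume "s \<in> ideal_power R (gen (weight_ge A a)) i" "t \<in> gen (weight_ge A a)"
      then show "s \<otimes> t \<in> gen (weight_ge A (a * Suc i))"
        using Suc by (intro gen_mult[of s "weight_ge A (a * i)" t "weight_ge A a"])
          (auto simp: weight_ge_def weight_add exponents_add)
    qed
  qed
  have "r \<in> gen (weight_ge A 0)" using r by (simp add: gen_exponents weight_ge_def)
  then obtain j where j: "j < n" "r \<in> gen (weight_ge A j)" "r \<notin> gen (weight_ge A (Suc j))"
    using notin by (induction n) (auto intro: less_SucI)
  have rpow: "r [^] i \<in> gen (weight_ge A (j * i))" for i :: nat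
    using pow[of j i] power_mem_ideal_power[OF j(2) r] by blast
  have "r [^] Suc i \<notin> gen (weight_ge A (Suc (j * Suc i)))" for i :: nat
  proof (induction i)
    case 0
    then show ?case using j r by simp
  next
    case (Suc i)
    then show ?case using mult_notin_gen_weight_ge[OF _ Suc r j(3)] r by (simp add: add.commute)
  qed
  then have "r [^] m \<notin> gen (weight_ge A (Suc (j * m)))" using m by (cases m) auto
  moreover have sum: "(\<Oplus>i\<in>{1..m}. c i \<otimes> r [^] (m - i)) \<in> gen (weight_ge A (Suc (j * m)))"
  proof (rule finsum_mem_ideal[OF gen_ideal])
    fix i assume i: "i \<in> {1..m}"
    \<comment> \<open>The term has order at least n i + j (m - i); j < n and i >= 1 make this at
      least j m + 1.\<close>
    have "j * m = j * i + j * (m - i)" using i by (simp add: add_mult_distrib2[symmetric])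
    moreover have "Suc j * i \<le> n * i" using j(1) by (intro mult_le_mono1) simp
    moreover have "1 \<le> i" using i by simp
    ultimately have le: "Suc (j * m) \<le> n * i + j * (m - i)" by (simp add: algebra_simps)
    show "c i \<otimes> r [^] (m - i) \<in> gen (weight_ge A (Suc (j * m)))"
    proof (rule gen_mult)
      show "c i \<in> gen (weight_ge A (n * i))" using c[OF i] pow by blast
      show "r [^] (m - i) \<in> gen (weight_ge A (j * (m - i)))" by (rule rpow)
      fix u v assume "u \<in> weight_ge A (n * i)" "v \<in> weight_ge A (j * (m - i))"
      then show "u + v \<in> weight_ge A (Suc (j * m))"
        using le by (auto simp: weight_ge_def weight_add exponents_add)
    qed
  qed simp
  moreover have "(\<Oplus>i\<in>{1..m}. c i \<otimes> r [^] (m - i)) \<oplus> r [^] m \<in> gen (weight_ge A (Suc (j * m)))"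
    using eq additive_subgroup.zero_closed[OF ideal.axioms(1)[OF gen_ideal]] gen_closed[OF sum] r
    by (simp add: a_comm)
  ultimately show False using ideal_add_cancel[OF gen_ideal sum] r by simp
qed

end

section \<open>Powers of minimal primes and normality\<close>

lemma (in cring) integral_closure_mono:
  assumes "ideal J R" "ideal K R" "J \<subseteq> K"
  shows "integral_closure R J \<subseteq> integral_closure R K"
  using ideal_power_mono[OF assms] unfolding integral_closure_def by blast

lemma (in cring) subset_integral_closure:
  assumes "ideal J R"
  shows "J \<subseteq> integral_closure R J"
proof
  fix a assume a: "a \<in> J"
  have ac: "a \<in> carrier R" by (rule ideal.Icarr[OF assms a])
  have na: "\<ominus> a \<in> ideal_power R J 1"
    using ideal_power_1[OF assms] additive_subgroup.a_inv_closed[OF ideal.axioms(1)[OF assms] a] by simp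
  have "a [^] (1::nat) \<oplus> (\<Oplus>i\<in>{1..1::nat}. \<ominus> a \<otimes> a [^] (1 - i)) = \<zero>"
    using ac by (simp add: r_neg)
  then show "a \<in> integral_closure R J"
    unfolding integral_closure_def using ac na
    by (intro CollectI conjI exI[of _ "1::nat"] exI[of _ "\<lambda>_. \<ominus> a"]) auto
qed

text \<open>One factor y is spent on each factor from P; with y outside P, this makes P^k part of
  the saturation of I^k.\<close>

lemma (in cring) power_mult_mem_ideal_power:
  assumes "ideal I R" "ideal P R" "y \<in> carrier R" "\<And>p. p \<in> P \<Longrightarrow> y \<otimes> p \<in> I" "a \<in> ideal_power R P k"
  shows "y [^] k \<otimes> a \<in> ideal_power R I k"
  using assms(5)
proof (induction k arbitrary: a)
  case 0
  then show ?case by simp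
next
  case (Suc k)
  have "ideal_power R P (Suc k) \<subseteq> {r \<in> carrier R. y [^] Suc k \<otimes> r \<in> ideal_power R I (Suc k)}"
    unfolding ideal_power_Suc[of P]
  proof (rule ideal_prod_subset)
    show "ideal {r \<in> carrier R. y [^] Suc k \<otimes> r \<in> ideal_power R I (Suc k)} R"
      using assms(3) by (intro colon_ideal ideal_power_ideal assms(1)) simp
    fix i j assume ij: "i \<in> ideal_power R P k" "j \<in> P"
    have c: "i \<in> carrier R" "j \<in> carrier R"
      using ideal.Icarr[OF ideal_power_ideal[OF assms(2)] ij(1)] ideal.Icarr[OF assms(2) ij(2)] by auto
    have "(y [^] k \<otimes> i) \<otimes> (y \<otimes> j) \<in> ideal_power R I (Suc k)"
      unfolding ideal_power_Suc using Suc.IH[OF ij(1)] assms(4)[OF ij(2)] by (rule ideal_prod.prod)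
    moreover have "(y [^] k \<otimes> i) \<otimes> (y \<otimes> j) = y [^] Suc k \<otimes> (i \<otimes> j)"
      using c assms(3) by (simp add: m_ac)
    ultimately show "i \<otimes> j \<in> {r \<in> carrier R. y [^] Suc k \<otimes> r \<in> ideal_power R I (Suc k)}" using c by simp
  qed
  then show ?case using Suc.prems by blast
qed

context prime_regular_sequence
begin

text \<open>P^k is saturated at P = P_A and contains I^k, which bounds the saturation from above.
  For the reverse, I is radical, so some y outside P satisfies y P inside I, and y^k carries P^k
  into I^k.\<close>

lemma saturation_ideal_power_mAss:
  assumes I: "ideal I R" "I = gen U" and rad: "radical R I \<subseteq> I"
    and P: "P \<in> mAss R (quot_module R I)"
  shows "saturation R P (ideal_power R I k) = ideal_power R P k"
proof (intro equalityI subsetI)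
  obtain A where A: "A \<subseteq> {1..d}" "P = gen (weight_ge A 1)" using mAss_gen[of P U] P I(2) by metis
  note pP = mAss_quot_moduleD[OF I(1) P]
  have iP: "ideal P R" by (rule primeideal.axioms(1)[OF pP(1)])
  fix r
  show "r \<in> ideal_power R P k" if r: "r \<in> saturation R P (ideal_power R I k)"
  proof -
    obtain s where s: "r \<in> carrier R" "s \<in> carrier R" "s \<notin> P" "s \<otimes> r \<in> ideal_power R I k"
      using r by (auto simp: saturation_def)
    have "r \<otimes> s \<in> ideal_power R P k" using s ideal_power_mono[OF I(1) iP pP(2)] m_comm by auto
    then have "r \<otimes> s \<in> gen (weight_ge A k)" using ideal_power_gen_weight_ge[OF A(1)] A(2) by simp
    \<comment> \<open>The cancellation condition holds because an exponent of A-weight zero leaves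
      the weight of a sum unchanged.\<close>
    then have "r \<in> gen (weight_ge A k)"
      using mult_notin_gen[OF s(1) _ s(2) s(3)[unfolded A(2)] upset_weight_ge[of A k]]
      by (auto simp: weight_ge_def weight_add)
    then show ?thesis using ideal_power_gen_weight_ge[OF A(1)] A(2) by simp
  qed
  show "r \<in> saturation R P (ideal_power R I k)" if r: "r \<in> ideal_power R P k"
  proof -
    obtain y where y: "y \<in> carrier R - P" "P = {r \<in> carrier R. y \<otimes> r \<in> I}"
      using radical_Ass_colon[OF I(1) rad] P by (auto simp: mAss_def)
    have "y [^] k \<otimes> r \<in> ideal_power R I k"
      by (rule power_mult_mem_ideal_power[OF I(1) iP _ _ r]) (use y in auto)
    moreover have "y [^] k \<in> carrier R - P" using y(1) primeideal_powerD[OF pP(1)] by auto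
    moreover have "r \<in> carrier R" using ideal.Icarr[OF ideal_power_ideal[OF iP] r] .
    ultimately show ?thesis by (auto simp: saturation_def)
  qed
qed

text \<open>Replacing each saturation in the symbolic power by P^k writes I^k as an intersection of
  powers of minimal primes. Each of them is integrally closed, and integral closure is monotone, so
  the intersection is integrally closed.\<close>

lemma squarefree_normal:
  assumes I: "squarefree_monomial_ideal R x d I"
    and sym: "\<And>k. k \<ge> 1 \<Longrightarrow> symbolic_power R I k = ideal_power R I k"
  shows "normal_ideal R I"
    and "\<And>k. k \<ge> 1 \<Longrightarrow>
      ideal_power R I k = carrier R \<inter> (\<Inter>P\<in>mAss R (quot_module R I). ideal_power R P k)"
proof -
  obtain S where S: "S \<subseteq> squarefree_monomials R x d" "I = Idl S"
    using I by (auto simp: squarefree_monomial_ideal_def)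
  have S': "S \<subseteq> monomials R x d" using S(1) by (auto simp: squarefree_monomials_def monomials_def)
  have Sc: "S \<subseteq> carrier R" using S' by (auto simp: monomials_def)
  have iI: "ideal I R" unfolding S(2) by (rule genideal_ideal[OF Sc])
  let ?U = "{e \<in> exponents. mon e \<in> I}"
  have IU: "I = gen ?U" by (rule genideal_monomials_eq_gen[OF S' S(2)])
  let ?M = "mAss R (quot_module R I)"
  show eq: "ideal_power R I k = carrier R \<inter> (\<Inter>P\<in>?M. ideal_power R P k)" if k: "k \<ge> 1" for k
    using symbolic_power_eq[OF iI k] sym[OF k]
      saturation_ideal_power_mAss[OF iI IU squarefree_monomial_ideal_radical[OF I]] by simp
  show "normal_ideal R I"
    unfolding normal_ideal_def integrally_closed_def
  proof (intro allI impI equalityI)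
    fix n :: nat assume n: "n \<ge> 1"
    let ?J = "ideal_power R I n"
    have J: "ideal ?J R" by (rule ideal_power_ideal[OF iI])
    show "?J \<subseteq> integral_closure R ?J" by (rule subset_integral_closure[OF J])
    show "integral_closure R ?J \<subseteq> ?J"
    proof
      fix r assume r: "r \<in> integral_closure R ?J"
      have "r \<in> ideal_power R P n" if P: "P \<in> ?M" for P
      proof -
        obtain A where A: "A \<subseteq> {1..d}" "P = gen (weight_ge A 1)" using mAss_gen[of P ?U] P IU by metis
        have Pn: "ideal_power R P n = gen (weight_ge A n)"
          using ideal_power_gen_weight_ge[OF A(1)] A(2) by simp
        have "?J \<subseteq> gen (weight_ge A n)" using eq[OF n] P Pn by auto
        then show ?thesis
          using integral_closure_mono[OF J gen_ideal] integral_closure_gen_weight_ge[OF A(1)] r Pn by blast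
      qed
      moreover have "r \<in> carrier R" using r by (simp add: integral_closure_def)
      ultimately show "r \<in> ?J" unfolding eq[OF n] by auto
    qed
  qed
qed

end

theorem theorem1p3:
  fixes R :: "('a, 'b) ring_scheme" and x :: "nat \<Rightarrow> 'a" and d :: nat and I :: "'a set"
  assumes "cring R" and "noetherian_ring R"
    and "regular_sequence R x d"
    and "x ` {1..d} \<subseteq> jacobson_radical R"
    and "primeideal (Idl\<^bsub>R\<^esub> (x ` {1..d})) R"
    and "monomial_ideal R x d I"
  shows "(\<forall>k\<ge>1. monomial_ideal R x d (symbolic_power R I k)) \<and>
    (squarefree_monomial_ideal R x d I \<longrightarrow>
      (\<forall>k\<ge>1. symbolic_power R I k = ideal_power R I k \<longleftrightarrow>
        Ass R (quot_module R (ideal_power R I k)) \<subseteq> Ass R (quot_module R I))) \<and>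
    (squarefree_monomial_ideal R x d I \<and>
      (\<forall>k\<ge>1. symbolic_power R I k = ideal_power R I k \<and>
        Ass R (quot_module R (ideal_power R I k)) \<subseteq> Ass R (quot_module R I)) \<longrightarrow>
      normal_ideal R I \<and>
      (\<forall>k\<ge>1. ideal_power R I k =
        carrier R \<inter> (\<Inter>p\<in>mAss R (quot_module R I). ideal_power R p k)))"
proof -
  interpret prime_regular_sequence R x d
    using assms(1-5)
    by (simp add: prime_regular_sequence_def noetherian_cring_def prime_regular_sequence_axioms_def)
  obtain S where S: "S \<subseteq> monomials R x d" "I = Idl\<^bsub>R\<^esub> S"
    using assms(6) by (auto simp: monomial_ideal_def)
  then have I: "ideal I R" by (auto simp: monomials_def intro!: genideal_ideal)
  show ?thesis
  proof (intro conjI impI allI)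
    show "monomial_ideal R x d (symbolic_power R I k)" if "k \<ge> 1" for k
      by (rule symbolic_power_monomial_ideal[OF assms(6) that])
    show "symbolic_power R I k = ideal_power R I k \<longleftrightarrow>
        Ass R (quot_module R (ideal_power R I k)) \<subseteq> Ass R (quot_module R I)"
      if "squarefree_monomial_ideal R x d I" "k \<ge> 1" for k
      by (rule symbolic_power_eq_ideal_power_iff[OF I squarefree_monomial_ideal_radical[OF that(1)] that(2)])
  qed (use squarefree_normal in blast)+
qed

end
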